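(* Let $E,E'$ be connected f-BCs and let $f:E\rightarrow E'$ be a regular covering. Then $\mathrm{Aut}(f)$ acts admissibly on $E$, and there exists an isomorphism of f-BCs $r:E/\mathrm{Aut}(f)\xrightarrow{\sim}E'$ such that $r\circ p=f$, where $p:E\rightarrow E/\mathrm{Aut}(f)$ is the natural projection.
   Context: Let $G=\langle g\rangle$ be a fixed infinite cyclic group. A fractional Brauer configuration (f-BC) is a quadruple $E=(E,P,L,d)$, where $E$ is a $G$-set, $P$ and $L$ are two partitions of $E$ (write $P(e)$, $L(e)$ for the classes containing $e\in E$), and $d:E\to\mathbb{Z}_{>0}$ is a function, such that: (f1) $L(e)\subseteq P(e)$ and $P(e)$ is a finite set for each $e\in E$; (f2) if $L(e_1)=L(e_2)$, then $P(g\cdot e_1)=P(g\cdot e_2)$; (f3) if $e_1,e_2$ belong to the same $G$-orbit, then $d(e_1)=d(e_2)$; (f4) $P(e_1)=P(e_2)$ if and only if $P(g^{d(e_1)}\cdot e_1)=P(g^{d(e_2)}\cdot e_2)$; (f5) $L(e_1)=L(e_2)$ if and only if $L(g^{d(e_1)}\cdot e_1)=L(g^{d(e_2)}\cdot e_2)$; (f6) the sequence $L(g^{d(e)-1}\cdot e)\cdots L(g\cdot e)L(e)$ is not a proper subsequence (block of consecutive terms) of $L(g^{d(h)-1}\cdot h)\cdots L(g\cdot h)L(h)$ for all $e,h\in E$. Elements of $E$ are called angles and the sets $P(e)$ polygons. A morphism of f-BCs $f:(E,P,L,d)\to(E',P',L',d')$ is a $G$-equivariant map with $f(P(e))\subseteq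 P'(f(e))$, $f(L(e))\subseteq L'(f(e))$ and $d'(f(e))=d(e)$ for all $e\in E$. It is an isomorphism if it has an inverse morphism. It is a covering if $f$ induces bijections $P(e)\to P'(f(e))$ and $L(e)\to L'(f(e))$ for all $e\in E$. A walk of $E$ is a sequence $w=(e_n|\delta_n|e_{n-1})\cdots(e_2|\delta_2|e_1)(e_1|\delta_1|e_0)$ with $e_i\in E$, $\delta_i\in\{g,g^{-1},\tau\}$, such that $e_i=g\cdot e_{i-1}$ if $\delta_i=g$, $e_i=g^{-1}\cdot e_{i-1}$ if $\delta_i=g^{-1}$, and $P(e_i)=P(e_{i-1})$ if $\delta_i=\tau$. It is abbreviated $(e_n|\delta_n\cdots\delta_1|e_0)$; $s(w)=e_0$, $t(w)=e_n$; $(e||e)$ is the walk of length $0$ at $e$. The composition $uv$ is defined by concatenation when $t(v)=s(u)$. $E$ is connected if any two angles can be connected by a walk. The homotopy relation $\sim$ is the smallest equivalence relation on walks such that: (h1) $(e|g^{-1}g|e)\sim(e|gg^{-1}|e)\sim(e|\tau|e)\sim(e||e)$; (h2) $(e_2|\tau|e_1)(e_1|\tau|e_0)\sim(e_2|\tau|e_0)$; (h3) $(g^{d(h)}\cdot h|\tau|g^{d(e)}\cdot e)(g^{d(e)}\cdot e|g^{d(e)}|e)\sim(g^{d(h)}\cdot h|g^{d(h)}|h)(h|\tau|e)$ whenever $P(e)=P(h)$; (h4) $(g\cdot h|\tau|g\cdot e)(g\cdot e|g|e)\sim(g\cdot h|g|h)(h|\tau|e)$ whenever $L(e)=L(h)$;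 (h5) if $w_1\sim w_2$ then $uw_1\sim uw_2$ and $w_1v\sim w_2v$ whenever the compositions make sense. The fundamental group $\Pi(E,e)$ is the group of homotopy classes of closed walks of $E$ at $e$ under composition. A morphism $f:E\to E'$ maps walks to walks, preserves homotopy, and induces a homomorphism $f_*:\Pi(E,e)\to\Pi(E',f(e))$. A covering $f:E\to E'$ of connected f-BCs is regular if $f_*(\Pi(E,e))$ is a normal subgroup of $\Pi(E',f(e))$ for some $e\in E$. $\mathrm{Aut}(f)$ is the group of isomorphisms of f-BCs $\phi:E\to E$ with $f\phi=f$. A group $\Pi$ of automorphisms of $E$ acts admissibly on $E$ if each $\Pi$-orbit of $E$ meets each polygon of $E$ in at most one angle. In that case the quotient $E/\Pi=(E/\Pi,P',L',d')$ is the f-BC whose underlying $G$-set is the set of $\Pi$-orbits $[e]$ with $g\cdot[e]=[g\cdot e]$, $P'([e])=\{[h]\mid h\in P(e)\}$, $L'([e])=\{[h]\mid h\in L(e)\}$, $d'([e])=d(e)$; the natural projection is $e\mapsto[e]$. *)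

theory Defs
  imports "HOL-Algebra.Group_Action" "HOL-Algebra.Generated_Groups" "HOL-Library.Disjoint_Sets" "HOL-Library.Sublist"
begin

definition infinite_cyclic_on :: "('g, 'm) monoid_scheme \<Rightarrow> 'g \<Rightarrow> bool" where
  "infinite_cyclic_on G g \<longleftrightarrow>
     group G \<and> g \<in> carrier G \<and> generate G {g} = carrier G \<and> infinite (carrier G)"

definition part_class :: "'a set set \<Rightarrow> 'a \<Rightarrow> 'a set" where
  "part_class Q e = (THE X. X \<in> Q \<and> e \<in> X)"

record ('g, 'a) fbc =
  angles :: "'a set"
  act :: "'g \<Rightarrow> 'a \<Rightarrow> 'a"
  polys :: "'a set set"
  lparts :: "'a set set"
  deg :: "'a \<Rightarrow> nat"

definition Pcl :: "('g, 'a) fbc \<Rightarrow> 'a \<Rightarrow> 'a set" where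
  "Pcl E e = part_class (polys E) e"

definition Lcl :: "('g, 'a) fbc \<Rightarrow> 'a \<Rightarrow> 'a set" where
  "Lcl E e = part_class (lparts E) e"

definition deg_shift :: "('g, 'm) monoid_scheme \<Rightarrow> 'g \<Rightarrow> ('g, 'a) fbc \<Rightarrow> 'a \<Rightarrow> 'a" where
  "deg_shift G g E e = act E (g [^]\<^bsub>G\<^esub> deg E e) e"

text \<open>The sequence \<open>L(g\<^sup>d\<^sup>-\<^sup>1 e) \<dots> L(g e) L(e)\<close> with \<open>d = d(e)\<close>, leftmost term first.\<close>

definition Lseq :: "('g, 'm) monoid_scheme \<Rightarrow> 'g \<Rightarrow> ('g, 'a) fbc \<Rightarrow> 'a \<Rightarrow> 'a set list" where
  "Lseq G g E e = map (\<lambda>i. Lcl E (act E (g [^]\<^bsub>G\<^esub> i) e)) (rev [0..<deg E e])"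

text \<open>
  The library predicate \<^const>\<open>group_action\<close> requires every \<open>act E a\<close> to be a bijection of the
  carrier that is extensional (equal to \<^const>\<open>undefined\<close> off the carrier).  The predicate
  \<^const>\<open>strict_sublist\<close> refers to blocks of consecutive terms.
\<close>

definition is_fbc :: "('g, 'm) monoid_scheme \<Rightarrow> 'g \<Rightarrow> ('g, 'a) fbc \<Rightarrow> bool" where
  "is_fbc G g E \<longleftrightarrow>
     group_action G (angles E) (act E) \<and>
     partition_on (angles E) (polys E) \<and>
     partition_on (angles E) (lparts E) \<and>
     (\<forall>e\<in>angles E. deg E e > 0) \<and>
     (\<forall>e\<in>angles E. Lcl E e \<subseteq> Pcl E e \<and> finite (Pcl E e)) \<and>
     (\<forall>e\<in>angles E. \<forall>h\<in>angles E.
        Lcl E e = Lcl E h \<longrightarrow> Pcl E (act E g e) = Pcl E (act E g h)) \<and>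
     (\<forall>e\<in>angles E. \<forall>h\<in>orbit G (act E) e. deg E e = deg E h) \<and>
     (\<forall>e\<in>angles E. \<forall>h\<in>angles E.
        Pcl E e = Pcl E h \<longleftrightarrow> Pcl E (deg_shift G g E e) = Pcl E (deg_shift G g E h)) \<and>
     (\<forall>e\<in>angles E. \<forall>h\<in>angles E.
        Lcl E e = Lcl E h \<longleftrightarrow> Lcl E (deg_shift G g E e) = Lcl E (deg_shift G g E h)) \<and>
     (\<forall>e\<in>angles E. \<forall>h\<in>angles E. \<not> strict_sublist (Lseq G g E e) (Lseq G g E h))"

definition fbc_morphism ::
  "('g, 'm) monoid_scheme \<Rightarrow> 'g \<Rightarrow> ('g, 'a) fbc \<Rightarrow> ('g, 'b) fbc \<Rightarrow> ('a \<Rightarrow> 'b) \<Rightarrow> bool" where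
  "fbc_morphism G g E E' f \<longleftrightarrow>
     is_fbc G g E \<and> is_fbc G g E' \<and>
     f \<in> angles E \<rightarrow> angles E' \<and>
     (\<forall>a\<in>carrier G. \<forall>e\<in>angles E. f (act E a e) = act E' a (f e)) \<and>
     (\<forall>e\<in>angles E. f ` Pcl E e \<subseteq> Pcl E' (f e) \<and> f ` Lcl E e \<subseteq> Lcl E' (f e) \<and>
        deg E' (f e) = deg E e)"

definition fbc_iso ::
  "('g, 'm) monoid_scheme \<Rightarrow> 'g \<Rightarrow> ('g, 'a) fbc \<Rightarrow> ('g, 'b) fbc \<Rightarrow> ('a \<Rightarrow> 'b) \<Rightarrow> bool" where
  "fbc_iso G g E E' f \<longleftrightarrow>
     fbc_morphism G g E E' f \<and>
     (\<exists>h. fbc_morphism G g E' E h \<and>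
        (\<forall>e\<in>angles E. h (f e) = e) \<and> (\<forall>e'\<in>angles E'. f (h e') = e'))"

definition fbc_covering ::
  "('g, 'm) monoid_scheme \<Rightarrow> 'g \<Rightarrow> ('g, 'a) fbc \<Rightarrow> ('g, 'b) fbc \<Rightarrow> ('a \<Rightarrow> 'b) \<Rightarrow> bool" where
  "fbc_covering G g E E' f \<longleftrightarrow>
     fbc_morphism G g E E' f \<and>
     (\<forall>e\<in>angles E. bij_betw f (Pcl E e) (Pcl E' (f e)) \<and> bij_betw f (Lcl E e) (Lcl E' (f e)))"

datatype direction = Fwd | Bwd | Tau

text \<open>
  \<open>Stay e\<close> is \<open>(e||e)\<close> and \<open>Step e \<delta> w\<close> is \<open>(e|\<delta>|t(w)) w\<close>; the symbols
  \<open>Fwd\<close>, \<open>Bwd\<close> and \<open>Tau\<close> stand for \<open>g\<close>, \<open>g\<^sup>-\<^sup>1\<close> and \<open>\<tau>\<close>.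
\<close>

datatype 'a walk = Stay 'a | Step 'a direction "'a walk"

fun wsource :: "'a walk \<Rightarrow> 'a" where
  "wsource (Stay e) = e"
| "wsource (Step e \<delta> w) = wsource w"

fun wtarget :: "'a walk \<Rightarrow> 'a" where
  "wtarget (Stay e) = e"
| "wtarget (Step e \<delta> w) = e"

text \<open>\<open>wcomp u v\<close> is \<open>uv\<close>; it is meaningful only if \<open>wtarget v = wsource u\<close>.\<close>

fun wcomp :: "'a walk \<Rightarrow> 'a walk \<Rightarrow> 'a walk" where
  "wcomp (Stay e) v = v"
| "wcomp (Step e \<delta> u) v = Step e \<delta> (wcomp u v)"

fun wstep ::
  "('g, 'm) monoid_scheme \<Rightarrow> 'g \<Rightarrow> ('g, 'a) fbc \<Rightarrow> direction \<Rightarrow> 'a \<Rightarrow> 'a \<Rightarrow> bool" where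
  "wstep G g E Fwd e e' \<longleftrightarrow> e' = act E g e"
| "wstep G g E Bwd e e' \<longleftrightarrow> e' = act E (inv\<^bsub>G\<^esub> g) e"
| "wstep G g E Tau e e' \<longleftrightarrow> Pcl E e' = Pcl E e"

fun is_walk :: "('g, 'm) monoid_scheme \<Rightarrow> 'g \<Rightarrow> ('g, 'a) fbc \<Rightarrow> 'a walk \<Rightarrow> bool" where
  "is_walk G g E (Stay e) \<longleftrightarrow> e \<in> angles E"
| "is_walk G g E (Step e \<delta> w) \<longleftrightarrow>
     is_walk G g E w \<and> e \<in> angles E \<and> wstep G g E \<delta> (wtarget w) e"

definition fbc_connected :: "('g, 'm) monoid_scheme \<Rightarrow> 'g \<Rightarrow> ('g, 'a) fbc \<Rightarrow> bool" where
  "fbc_connected G g E \<longleftrightarrow>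
     (\<forall>e\<in>angles E. \<forall>h\<in>angles E. \<exists>w. is_walk G g E w \<and> wsource w = e \<and> wtarget w = h)"

text \<open>\<open>gwalk G g E n e\<close> is the walk \<open>(g\<^sup>n e|g\<^sup>n|e)\<close>.\<close>

fun gwalk :: "('g, 'm) monoid_scheme \<Rightarrow> 'g \<Rightarrow> ('g, 'a) fbc \<Rightarrow> nat \<Rightarrow> 'a \<Rightarrow> 'a walk" where
  "gwalk G g E 0 e = Stay e"
| "gwalk G g E (Suc n) e = Step (act E (g [^]\<^bsub>G\<^esub> Suc n) e) Fwd (gwalk G g E n e)"

inductive homotopic ::
  "('g, 'm) monoid_scheme \<Rightarrow> 'g \<Rightarrow> ('g, 'a) fbc \<Rightarrow> 'a walk \<Rightarrow> 'a walk \<Rightarrow> bool"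
  for G g E where
  refl: "is_walk G g E w \<Longrightarrow> homotopic G g E w w"
| sym: "homotopic G g E v w \<Longrightarrow> homotopic G g E w v"
| trans: "homotopic G g E u v \<Longrightarrow> homotopic G g E v w \<Longrightarrow> homotopic G g E u w"
| h1_bwd_fwd: "e \<in> angles E \<Longrightarrow>
    homotopic G g E (Step e Bwd (Step (act E g e) Fwd (Stay e))) (Stay e)"
| h1_fwd_bwd: "e \<in> angles E \<Longrightarrow>
    homotopic G g E (Step e Fwd (Step (act E (inv\<^bsub>G\<^esub> g) e) Bwd (Stay e))) (Stay e)"
| h1_tau: "e \<in> angles E \<Longrightarrow> homotopic G g E (Step e Tau (Stay e)) (Stay e)"
| h2: "e0 \<in> angles E \<Longrightarrow> e1 \<in> angles E \<Longrightarrow> e2 \<in> angles E \<Longrightarrow>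
    Pcl E e1 = Pcl E e0 \<Longrightarrow> Pcl E e2 = Pcl E e1 \<Longrightarrow>
    homotopic G g E (Step e2 Tau (Step e1 Tau (Stay e0))) (Step e2 Tau (Stay e0))"
| h3: "e \<in> angles E \<Longrightarrow> h \<in> angles E \<Longrightarrow> Pcl E e = Pcl E h \<Longrightarrow>
    homotopic G g E
      (Step (deg_shift G g E h) Tau (gwalk G g E (deg E e) e))
      (wcomp (gwalk G g E (deg E h) h) (Step h Tau (Stay e)))"
| h4: "e \<in> angles E \<Longrightarrow> h \<in> angles E \<Longrightarrow> Lcl E e = Lcl E h \<Longrightarrow>
    homotopic G g E
      (Step (act E g h) Tau (Step (act E g e) Fwd (Stay e)))
      (Step (act E g h) Fwd (Step h Tau (Stay e)))"
| h5_left: "homotopic G g E w1 w2 \<Longrightarrow> is_walk G g E u \<Longrightarrow>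
    wtarget w1 = wsource u \<Longrightarrow> wtarget w2 = wsource u \<Longrightarrow>
    homotopic G g E (wcomp u w1) (wcomp u w2)"
| h5_right: "homotopic G g E w1 w2 \<Longrightarrow> is_walk G g E v \<Longrightarrow>
    wtarget v = wsource w1 \<Longrightarrow> wtarget v = wsource w2 \<Longrightarrow>
    homotopic G g E (wcomp w1 v) (wcomp w2 v)"

definition homotopy_rel ::
  "('g, 'm) monoid_scheme \<Rightarrow> 'g \<Rightarrow> ('g, 'a) fbc \<Rightarrow> ('a walk \<times> 'a walk) set" where
  "homotopy_rel G g E = {(v, w). homotopic G g E v w}"

definition closed_walks ::
  "('g, 'm) monoid_scheme \<Rightarrow> 'g \<Rightarrow> ('g, 'a) fbc \<Rightarrow> 'a \<Rightarrow> 'a walk set" where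
  "closed_walks G g E e = {w. is_walk G g E w \<and> wsource w = e \<and> wtarget w = e}"

text \<open>
  By (h5) the union defining the product of two classes is the single class of any composition
  of representatives.
\<close>

definition fund_group ::
  "('g, 'm) monoid_scheme \<Rightarrow> 'g \<Rightarrow> ('g, 'a) fbc \<Rightarrow> 'a \<Rightarrow> 'a walk set monoid" where
  "fund_group G g E e =
     \<lparr>carrier = closed_walks G g E e // homotopy_rel G g E,
      mult = (\<lambda>A B. \<Union>u\<in>A. \<Union>v\<in>B. homotopy_rel G g E `` {wcomp u v}),
      one = homotopy_rel G g E `` {Stay e}\<rparr>"

text \<open>
  \<open>fund_map\<close> is \<open>f\<^sub>*\<close> on homotopy classes: for a morphism \<open>f\<close>, all walks in the class \<open>A\<close> have
  homotopic images, so the union is a single class.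
\<close>

definition fund_map ::
  "('g, 'm) monoid_scheme \<Rightarrow> 'g \<Rightarrow> ('g, 'b) fbc \<Rightarrow> ('a \<Rightarrow> 'b) \<Rightarrow> 'a walk set \<Rightarrow> 'b walk set" where
  "fund_map G g E' f A = (\<Union>w\<in>A. homotopy_rel G g E' `` {map_walk f w})"

definition regular_covering ::
  "('g, 'm) monoid_scheme \<Rightarrow> 'g \<Rightarrow> ('g, 'a) fbc \<Rightarrow> ('g, 'b) fbc \<Rightarrow> ('a \<Rightarrow> 'b) \<Rightarrow> bool" where
  "regular_covering G g E E' f \<longleftrightarrow>
     fbc_connected G g E \<and> fbc_connected G g E' \<and> fbc_covering G g E E' f \<and>
     (\<exists>e\<in>angles E.
        fund_map G g E' f ` carrier (fund_group G g E e) \<lhd> fund_group G g E' (f e))"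

text \<open>
  Automorphisms are taken in \<^const>\<open>BijGroup\<close>, that is, extensional on the set of angles, so that
  functions agreeing on all angles are identified.
\<close>

definition fbc_Aut ::
  "('g, 'm) monoid_scheme \<Rightarrow> 'g \<Rightarrow> ('g, 'a) fbc \<Rightarrow> ('a \<Rightarrow> 'a) set" where
  "fbc_Aut G g E = {\<phi> \<in> extensional (angles E). fbc_iso G g E E \<phi>}"

definition Aut_over ::
  "('g, 'm) monoid_scheme \<Rightarrow> 'g \<Rightarrow> ('g, 'a) fbc \<Rightarrow> ('a \<Rightarrow> 'b) \<Rightarrow> ('a \<Rightarrow> 'a) set" where
  "Aut_over G g E f = {\<phi> \<in> fbc_Aut G g E. \<forall>e\<in>angles E. f (\<phi> e) = f e}"

text \<open>The group \<open>H\<close>, a set of bijections of the angles, acts by evaluation.\<close>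

definition aut_orbit :: "('g, 'a) fbc \<Rightarrow> ('a \<Rightarrow> 'a) set \<Rightarrow> 'a \<Rightarrow> 'a set" where
  "aut_orbit E H e = orbit (BijGroup (angles E)\<lparr>carrier := H\<rparr>) (\<lambda>\<phi>. \<phi>) e"

definition acts_admissibly ::
  "('g, 'm) monoid_scheme \<Rightarrow> 'g \<Rightarrow> ('g, 'a) fbc \<Rightarrow> ('a \<Rightarrow> 'a) set \<Rightarrow> bool" where
  "acts_admissibly G g E H \<longleftrightarrow>
     subgroup H (BijGroup (angles E)) \<and> H \<subseteq> fbc_Aut G g E \<and>
     (\<forall>e\<in>angles E. \<forall>X\<in>polys E.
        \<forall>x\<in>aut_orbit E H e \<inter> X. \<forall>y\<in>aut_orbit E H e \<inter> X. x = y)"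

text \<open>
  On orbits, \<open>act E a ` [e] = [act E a e]\<close>, and \<^const>\<open>deg\<close> is constant; on partition classes,
  \<open>aut_orbit E H ` P(e) = {[h] | h \<in> P(e)}\<close>.
\<close>

definition quotient_fbc :: "('g, 'a) fbc \<Rightarrow> ('a \<Rightarrow> 'a) set \<Rightarrow> ('g, 'a set) fbc" where
  "quotient_fbc E H =
     \<lparr>angles = aut_orbit E H ` angles E,
      act = (\<lambda>a. \<lambda>X\<in>aut_orbit E H ` angles E. act E a ` X),
      polys = (\<lambda>X. aut_orbit E H ` X) ` polys E,
      lparts = (\<lambda>X. aut_orbit E H ` X) ` lparts E,
      deg = (\<lambda>X. THE n. \<forall>e\<in>X. deg E e = n)\<rparr>"

end

theory Submission
  imports Defs
begin

text \<open>
  A covering lifts walks uniquely, and by (f2) and (f4) homotopic walks have lifts with the same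
  end. Normality of \<open>f\<^sub>*(\<Pi>(E,e))\<close> says that whether a lift of a closed walk is closed does not depend
  on the point of the fibre where it starts. Hence, for \<open>x\<close> and \<open>y\<close> in one fibre, sending the end of a
  walk \<open>w\<close> from \<open>x\<close> to the end of the lift of \<open>f w\<close> at \<open>y\<close> is a well-defined automorphism over \<open>E'\<close>.
  So the orbits of \<open>Aut(f)\<close> are exactly the fibres of \<open>f\<close>, a polygon meets a fibre at most once, and the
  quotient is \<open>E'\<close> with its structure carried along \<open>e' \<mapsto> f\<^sup>-\<^sup>1(e')\<close>.
\<close>

section \<open>Classes of a partition and their images under an injection\<close>

lemma part_class_eqI:
  assumes "partition_on A Q" "X \<in> Q" "e \<in> X"
  shows "part_class Q e = X"
  unfolding part_class_def
proof (rule the_equality)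
  show "X \<in> Q \<and> e \<in> X" using assms by simp
  show "Y = X" if "Y \<in> Q \<and> e \<in> Y" for Y
    using assms that unfolding partition_on_def disjoint_def by blast
qed

lemma part_class_in:
  assumes "partition_on A Q" "e \<in> A"
  shows "part_class Q e \<in> Q" "e \<in> part_class Q e"
proof -
  obtain X where "X \<in> Q" "e \<in> X" using assms unfolding partition_on_def by blast
  then show "part_class Q e \<in> Q" "e \<in> part_class Q e"
    using part_class_eqI[OF assms(1)] by auto
qed

lemma part_class_subset:
  assumes "partition_on A Q" "e \<in> A"
  shows "part_class Q e \<subseteq> A"
  using part_class_in[OF assms] assms(1) unfolding partition_on_def by blast

lemma part_class_eq_iff:
  assumes "partition_on A Q" "e \<in> A" "h \<in> A"
  shows "part_class Q e = part_class Q h \<longleftrightarrow> h \<in> part_class Q e"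
  using part_class_in[OF assms(1,2)] part_class_in[OF assms(1,3)] part_class_eqI[OF assms(1)]
  by metis

lemma part_class_image:
  assumes Q: "partition_on A Q" and inj: "inj_on s A"
    and Q': "partition_on (s ` A) ((`) s ` Q)" and e: "e \<in> A"
  shows "part_class ((`) s ` Q) (s e) = s ` part_class Q e"
  using part_class_in[OF Q e] by (intro part_class_eqI[OF Q']) auto

lemma partition_on_image:
  assumes "partition_on A Q" "inj_on s A"
  shows "partition_on (s ` A) ((`) s ` Q)"
proof (rule partition_onI)
  show "\<Union> ((`) s ` Q) = s ` A" using assms(1) unfolding partition_on_def by blast
  show "{} \<notin> (`) s ` Q" using assms(1) unfolding partition_on_def by auto
  show "disjnt p p'" if p: "p \<in> (`) s ` Q" "p' \<in> (`) s ` Q" "p \<noteq> p'" for p p'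
  proof -
    obtain X Y where XY: "X \<in> Q" "Y \<in> Q" "p = s ` X" "p' = s ` Y" using p by blast
    then have "X \<subseteq> A" "Y \<subseteq> A" "X \<inter> Y = {}"
      using assms(1) p(3) unfolding partition_on_def disjoint_def by auto
    then show ?thesis
      using XY inj_on_image_Int[OF assms(2)] unfolding disjnt_def by (metis image_empty)
  qed
qed

text \<open>A block of \<open>map h ys\<close> is the image of a block of \<open>ys\<close>, and
  injectivity on the entries identifies that block with \<open>xs\<close>. This carries (f6) over
  when classes are renamed.\<close>

lemma strict_sublist_map_inj_on:
  assumes "strict_sublist (map h xs) (map h ys)" "inj_on h (set xs \<union> set ys)"
  shows "strict_sublist xs ys"
proof -
  obtain ps ss where "map h ys = ps @ map h xs @ ss"
    using assms(1) unfolding strict_sublist_def sublist_def by blast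
  then obtain as bs cs where ys: "ys = as @ bs @ cs" and "map h bs = map h xs"
    by (metis map_eq_append_conv)
  moreover have "inj_on h (set bs \<union> set xs)"
    using ys by (intro inj_on_subset[OF assms(2)]) auto
  ultimately have "bs = xs" using map_inj_on by blast
  then have "sublist xs ys" using ys unfolding sublist_def by blast
  moreover have "xs \<noteq> ys" using assms(1) by auto
  ultimately show ?thesis by (simp add: strict_sublist_def)
qed

section \<open>Composites and images of walks\<close>

lemma wsource_wcomp [simp]: "wsource (wcomp u v) = wsource v" if "wtarget v = wsource u"
  using that by (induction u) auto

lemma wtarget_wcomp [simp]: "wtarget (wcomp u v) = wtarget u" if "wtarget v = wsource u"
  using that by (induction u) auto

lemma is_walk_wcomp:
  "is_walk G g E u \<Longrightarrow> is_walk G g E v \<Longrightarrow> wtarget v = wsource u \<Longrightarrow> is_walk G g E (wcomp u v)"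
  by (induction u) auto

lemma map_walk_wcomp: "map_walk f (wcomp u v) = wcomp (map_walk f u) (map_walk f v)"
  by (induction u) auto

lemma wsource_map_walk [simp]: "wsource (map_walk f w) = f (wsource w)"
  by (induction w) auto

lemma wtarget_map_walk [simp]: "wtarget (map_walk f w) = f (wtarget w)"
  by (cases w) auto

lemma wsource_in_angles: "is_walk G g E w \<Longrightarrow> wsource w \<in> angles E"
  by (induction w) auto

lemma wtarget_in_angles: "is_walk G g E w \<Longrightarrow> wtarget w \<in> angles E"
  by (cases w) auto

section \<open>Consequences of the axioms of an f-BC\<close>

locale fbc =
  fixes G :: "('g, 'm) monoid_scheme" and g :: 'g and E :: "('g, 'a) fbc"
  assumes cyclic: "infinite_cyclic_on G g" and fbc: "is_fbc G g E"
begin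

lemma group: "group G" and g_carrier: "g \<in> carrier G"
  using cyclic by (auto simp: infinite_cyclic_on_def)

lemma inv_g_carrier: "inv\<^bsub>G\<^esub> g \<in> carrier G"
  using group g_carrier by (simp add: group.inv_closed)

lemma pow_g_carrier: "g [^]\<^bsub>G\<^esub> (n::nat) \<in> carrier G"
  using group g_carrier by (simp add: group.is_monoid monoid.nat_pow_closed)

lemma action: "group_action G (angles E) (act E)"
  and polys: "partition_on (angles E) (polys E)"
  and lparts: "partition_on (angles E) (lparts E)"
  using fbc by (auto simp: is_fbc_def)

lemma act_closed: "a \<in> carrier G \<Longrightarrow> e \<in> angles E \<Longrightarrow> act E a e \<in> angles E"
  using group_action.element_image[OF action] by blast

lemma act_mult:
  "a \<in> carrier G \<Longrightarrow> b \<in> carrier G \<Longrightarrow> e \<in> angles E \<Longrightarrow>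
    act E (a \<otimes>\<^bsub>G\<^esub> b) e = act E a (act E b e)"
  using group_action.composition_rule[OF action] by blast

lemma act_one: "e \<in> angles E \<Longrightarrow> act E \<one>\<^bsub>G\<^esub> e = e"
  using group_action.id_eq_one[OF action] by (metis restrict_apply')

lemma act_inv_left: "a \<in> carrier G \<Longrightarrow> e \<in> angles E \<Longrightarrow> act E (inv\<^bsub>G\<^esub> a) (act E a e) = e"
  using act_mult[of "inv\<^bsub>G\<^esub> a" a e] group act_one by (simp add: group.l_inv)

lemma act_inv_right: "a \<in> carrier G \<Longrightarrow> e \<in> angles E \<Longrightarrow> act E a (act E (inv\<^bsub>G\<^esub> a) e) = e"
  using act_mult[of a "inv\<^bsub>G\<^esub> a" e] group act_one by (simp add: group.r_inv)

text \<open>In a power, \<open>Suc\<close> adds a factor on the right, whereas here \<open>g\<close>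
  is applied last; powers of \<open>g\<close> commute with \<open>g\<close>.\<close>

lemma act_pow_Suc:
  "e \<in> angles E \<Longrightarrow> act E (g [^]\<^bsub>G\<^esub> Suc n) e = act E g (act E (g [^]\<^bsub>G\<^esub> n) e)"
  using act_mult[OF g_carrier pow_g_carrier[of n], of e] monoid.nat_pow_Suc2[OF _ g_carrier, of n]
    group.is_monoid[OF group] by simp

lemma deg_shift_closed: "e \<in> angles E \<Longrightarrow> deg_shift G g E e \<in> angles E"
  unfolding deg_shift_def using act_closed pow_g_carrier by blast

lemma Pcl_self: "e \<in> angles E \<Longrightarrow> e \<in> Pcl E e"
  and Pcl_in_polys: "e \<in> angles E \<Longrightarrow> Pcl E e \<in> polys E"
  and Pcl_subset: "e \<in> angles E \<Longrightarrow> Pcl E e \<subseteq> angles E"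
  and Lcl_self: "e \<in> angles E \<Longrightarrow> e \<in> Lcl E e"
  and Lcl_in_lparts: "e \<in> angles E \<Longrightarrow> Lcl E e \<in> lparts E"
  and Lcl_subset: "e \<in> angles E \<Longrightarrow> Lcl E e \<subseteq> angles E"
  unfolding Pcl_def Lcl_def
  using part_class_in[OF polys] part_class_subset[OF polys]
    part_class_in[OF lparts] part_class_subset[OF lparts] by blast+

lemma Pcl_eqI: "X \<in> polys E \<Longrightarrow> e \<in> X \<Longrightarrow> Pcl E e = X"
  and Lcl_eqI: "X \<in> lparts E \<Longrightarrow> e \<in> X \<Longrightarrow> Lcl E e = X"
  unfolding Pcl_def Lcl_def using part_class_eqI[OF polys] part_class_eqI[OF lparts] by blast+

lemma Pcl_eq_iff: "e \<in> angles E \<Longrightarrow> h \<in> angles E \<Longrightarrow> Pcl E e = Pcl E h \<longleftrightarrow> h \<in> Pcl E e"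
  and Lcl_eq_iff: "e \<in> angles E \<Longrightarrow> h \<in> angles E \<Longrightarrow> Lcl E e = Lcl E h \<longleftrightarrow> h \<in> Lcl E e"
  unfolding Pcl_def Lcl_def using part_class_eq_iff[OF polys] part_class_eq_iff[OF lparts] by blast+

lemma polys_eq: "polys E = Pcl E ` angles E"
proof
  show "polys E \<subseteq> Pcl E ` angles E"
  proof
    fix X assume X: "X \<in> polys E"
    then have "X \<noteq> {}" "X \<subseteq> angles E" using polys unfolding partition_on_def by blast+
    then obtain e where "e \<in> X" "e \<in> angles E" by blast
    then show "X \<in> Pcl E ` angles E" using Pcl_eqI[OF X] by blast
  qed
qed (use Pcl_in_polys in auto)

lemma lparts_eq: "lparts E = Lcl E ` angles E"
proof
  show "lparts E \<subseteq> Lcl E ` angles E"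
  proof
    fix X assume X: "X \<in> lparts E"
    then have "X \<noteq> {}" "X \<subseteq> angles E" using lparts unfolding partition_on_def by blast+
    then obtain e where "e \<in> X" "e \<in> angles E" by blast
    then show "X \<in> Lcl E ` angles E" using Lcl_eqI[OF X] by blast
  qed
qed (use Lcl_in_lparts in auto)

lemma Lcl_subset_Pcl: "e \<in> angles E \<Longrightarrow> Lcl E e \<subseteq> Pcl E e"
  and finite_Pcl: "e \<in> angles E \<Longrightarrow> finite (Pcl E e)"
  and deg_pos: "e \<in> angles E \<Longrightarrow> deg E e > 0"
  and Lcl_act: "\<lbrakk>e \<in> angles E; h \<in> angles E; Lcl E e = Lcl E h\<rbrakk>
    \<Longrightarrow> Pcl E (act E g e) = Pcl E (act E g h)"
  and deg_orbit: "e \<in> angles E \<Longrightarrow> h \<in> orbit G (act E) e \<Longrightarrow> deg E e = deg E h"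
  and Pcl_deg_shift: "e \<in> angles E \<Longrightarrow> h \<in> angles E \<Longrightarrow>
    Pcl E e = Pcl E h \<longleftrightarrow> Pcl E (deg_shift G g E e) = Pcl E (deg_shift G g E h)"
  and Lcl_deg_shift: "e \<in> angles E \<Longrightarrow> h \<in> angles E \<Longrightarrow>
    Lcl E e = Lcl E h \<longleftrightarrow> Lcl E (deg_shift G g E e) = Lcl E (deg_shift G g E h)"
  and Lseq_incomparable: "e \<in> angles E \<Longrightarrow> h \<in> angles E \<Longrightarrow>
    \<not> strict_sublist (Lseq G g E e) (Lseq G g E h)"
proof -
  \<comment> \<open>The conjunction \<open>conds\<close> begins with the positivity of
    \<open>deg\<close>, and \<open>conds2\<close> begins with (f3).\<close>
  note conds = fbc[unfolded is_fbc_def, THEN conjunct2, THEN conjunct2, THEN conjunct2]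
  note conds2 = conds[THEN conjunct2, THEN conjunct2, THEN conjunct2]
  show "e \<in> angles E \<Longrightarrow> Lcl E e \<subseteq> Pcl E e" "e \<in> angles E \<Longrightarrow> finite (Pcl E e)"
    using conds[THEN conjunct2, THEN conjunct1] by blast+
  show "e \<in> angles E \<Longrightarrow> deg E e > 0"
    using conds[THEN conjunct1] by blast
  show "\<lbrakk>e \<in> angles E; h \<in> angles E; Lcl E e = Lcl E h\<rbrakk> \<Longrightarrow> Pcl E (act E g e) = Pcl E (act E g h)"
    using conds[THEN conjunct2, THEN conjunct2, THEN conjunct1] by blast
  show "e \<in> angles E \<Longrightarrow> h \<in> orbit G (act E) e \<Longrightarrow> deg E e = deg E h"
    using conds2[THEN conjunct1] by blast
  show "e \<in> angles E \<Longrightarrow> h \<in> angles E \<Longrightarrow>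
    Pcl E e = Pcl E h \<longleftrightarrow> Pcl E (deg_shift G g E e) = Pcl E (deg_shift G g E h)"
    using conds2[THEN conjunct2, THEN conjunct1] by blast
  show "e \<in> angles E \<Longrightarrow> h \<in> angles E \<Longrightarrow>
    Lcl E e = Lcl E h \<longleftrightarrow> Lcl E (deg_shift G g E e) = Lcl E (deg_shift G g E h)"
    using conds2[THEN conjunct2, THEN conjunct2, THEN conjunct1] by blast
  show "e \<in> angles E \<Longrightarrow> h \<in> angles E \<Longrightarrow> \<not> strict_sublist (Lseq G g E e) (Lseq G g E h)"
    using conds2[THEN conjunct2, THEN conjunct2, THEN conjunct2] by blast
qed

lemma deg_act: "a \<in> carrier G \<Longrightarrow> e \<in> angles E \<Longrightarrow> deg E (act E a e) = deg E e"
  using deg_orbit[of e "act E a e", symmetric] by (simp add: orbit_def) blast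

lemma wsource_gwalk: "wsource (gwalk G g E n e) = e"
  by (induction n) auto

lemma wtarget_gwalk: "e \<in> angles E \<Longrightarrow> wtarget (gwalk G g E n e) = act E (g [^]\<^bsub>G\<^esub> n) e"
  by (cases n) (auto simp: act_one)

lemma is_walk_gwalk: "e \<in> angles E \<Longrightarrow> is_walk G g E (gwalk G g E n e)"
proof (induction n)
  case (Suc n)
  then show ?case
    using act_pow_Suc[of e n] act_closed[OF g_carrier] act_closed[OF pow_g_carrier]
    by (simp add: wtarget_gwalk)
qed simp

text \<open>Beyond the action, only two generators draw on the axioms: (f4) makes the last \<tau>
  step on the left of (h3) legal, and (f2) and (f1) do so for the \<tau> steps on the two sides of
  (h4).\<close>

lemma homotopic_walks:
  assumes "homotopic G g E v w"
  shows "is_walk G g E v \<and> is_walk G g E w \<and> wsource v = wsource w \<and> wtarget v = wtarget w"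
  using assms
proof induction
  case (h3 e h)
  then show ?case
    using Pcl_deg_shift[OF h3(1,2)] deg_shift_closed
    by (auto simp: wsource_gwalk wtarget_gwalk is_walk_gwalk deg_shift_def[symmetric]
        intro!: is_walk_wcomp)
next
  case (h4 e h)
  have "Pcl E e = Pcl E h"
    using h4 Lcl_self Lcl_subset_Pcl Pcl_eq_iff by (metis subsetD)
  then show ?case using h4 Lcl_act[OF h4] act_closed[OF g_carrier] by auto
qed (auto simp: is_walk_wcomp act_closed g_carrier inv_g_carrier act_inv_left act_inv_right)

section \<open>Transport of structure along an injection\<close>

text \<open>All data of \<open>Q\<close> are those of \<open>E\<close> renamed by \<open>s\<close>,
  so each axiom for \<open>Q\<close> is the one for \<open>E\<close> read through \<open>s\<close>.
  That \<open>Q\<close> is an f-BC is part of the conclusion; this is how the quotient is later seen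
  to be one.\<close>

lemma transport:
  fixes Q :: "('g, 'b) fbc" and s :: "'a \<Rightarrow> 'b"
  assumes inj: "inj_on s (angles E)" and angles_Q: "angles Q = s ` angles E"
    and act_Q: "\<And>a e. a \<in> carrier G \<Longrightarrow> e \<in> angles E \<Longrightarrow> act Q a (s e) = s (act E a e)"
    and ext_Q: "\<And>a. a \<in> carrier G \<Longrightarrow> act Q a \<in> extensional (angles Q)"
    and polys_Q: "polys Q = (`) s ` polys E" and lparts_Q: "lparts Q = (`) s ` lparts E"
    and deg_Q: "\<And>e. e \<in> angles E \<Longrightarrow> deg Q (s e) = deg E e"
  shows "fbc_iso G g Q E (inv_into (angles E) s)"
proof -
  let ?r = "inv_into (angles E) s"
  have rs: "?r (s e) = e" if "e \<in> angles E" for e using that inj by simp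
  have Pcl_Q: "Pcl Q (s e) = s ` Pcl E e" and Lcl_Q: "Lcl Q (s e) = s ` Lcl E e"
    if "e \<in> angles E" for e
    unfolding Pcl_def Lcl_def polys_Q lparts_Q
    using part_class_image[OF polys inj _ that] part_class_image[OF lparts inj _ that]
      partition_on_image[OF polys inj] partition_on_image[OF lparts inj] by auto
  \<comment> \<open>The sequences in (f6) have classes as terms, so injectivity is needed on sets of
    angles.\<close>
  have image_inj: "inj_on ((`) s) (Pow (angles E))"
    using inj by (rule inj_on_image_Pow)
  have P_iff: "Pcl Q (s e) = Pcl Q (s h) \<longleftrightarrow> Pcl E e = Pcl E h"
    and L_iff: "Lcl Q (s e) = Lcl Q (s h) \<longleftrightarrow> Lcl E e = Lcl E h"
    if "e \<in> angles E" "h \<in> angles E" for e h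
    using that Pcl_Q Lcl_Q Pcl_subset Lcl_subset
    by (auto simp: inj_on_image_eq_iff[OF inj])
  have shift_Q: "deg_shift G g Q (s e) = s (deg_shift G g E e)" if "e \<in> angles E" for e
    using that by (simp add: deg_shift_def deg_Q act_Q pow_g_carrier)
  have Lseq_Q: "Lseq G g Q (s e) = map ((`) s) (Lseq G g E e)" if "e \<in> angles E" for e
    using that by (simp add: Lseq_def deg_Q act_Q pow_g_carrier Lcl_Q act_closed)
  have Lseq_Pow: "set (Lseq G g E e) \<subseteq> Pow (angles E)" if "e \<in> angles E" for e
    using that Lcl_subset[OF act_closed[OF pow_g_carrier]] by (auto simp: Lseq_def)
  have action_Q: "group_action G (angles Q) (act Q)"
  proof -
    \<comment> \<open>Membership in \<open>Bij\<close> also asks for extensionality, which is what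
      \<open>ext_Q\<close> provides; the inverse permutation is the action of the inverse
      element.\<close>
    have bij: "act Q a \<in> Bij (angles Q)" if a: "a \<in> carrier G" for a
    proof -
      have "inv\<^bsub>G\<^esub> a \<in> carrier G" using group a by (simp add: group.inv_closed)
      then have "bij_betw (act Q a) (angles Q) (angles Q)"
        using a
        by (intro bij_betw_byWitness[where f' = "act Q (inv\<^bsub>G\<^esub> a)"])
          (auto simp: angles_Q act_Q act_closed act_inv_left act_inv_right)
      then show ?thesis using ext_Q[OF a] by (simp add: Bij_def)
    qed
    have mult: "act Q (a \<otimes>\<^bsub>G\<^esub> b) = compose (angles Q) (act Q a) (act Q b)"
      if "a \<in> carrier G" "b \<in> carrier G" for a b
    proof (rule extensionalityI[of _ "angles Q"])
      show "act Q (a \<otimes>\<^bsub>G\<^esub> b) \<in> extensional (angles Q)"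
        using that group ext_Q by (simp add: group.is_monoid monoid.m_closed)
      show "act Q (a \<otimes>\<^bsub>G\<^esub> b) x = compose (angles Q) (act Q a) (act Q b) x"
        if "x \<in> angles Q" for x
        using \<open>a \<in> carrier G\<close> \<open>b \<in> carrier G\<close> that group
        by (auto simp: angles_Q compose_def act_Q act_mult act_closed group.is_monoid monoid.m_closed)
    qed simp
    have "act Q \<in> hom G (BijGroup (angles Q))"
      using bij mult by (auto simp: hom_def BijGroup_def)
    then show ?thesis
      unfolding group_action_def group_hom_def group_hom_axioms_def
      using group group_BijGroup by blast
  qed
  have orbit_deg: "deg Q (s e) = deg Q h" if "e \<in> angles E" "h \<in> orbit G (act Q) (s e)" for e h
    using that by (auto simp: orbit_def act_Q deg_Q act_closed deg_act)
  have fbc_Q: "is_fbc G g Q"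
    unfolding is_fbc_def
  proof (intro conjI)
    show "partition_on (angles Q) (polys Q)" "partition_on (angles Q) (lparts Q)"
      using partition_on_image[OF polys inj] partition_on_image[OF lparts inj]
      by (simp_all add: angles_Q polys_Q lparts_Q)
    show "\<forall>e\<in>angles Q. deg Q e > 0" using deg_pos by (simp add: angles_Q deg_Q)
    show "\<forall>e\<in>angles Q. Lcl Q e \<subseteq> Pcl Q e \<and> finite (Pcl Q e)"
      using Lcl_subset_Pcl finite_Pcl by (auto simp: angles_Q Pcl_Q Lcl_Q)
    show "\<forall>e\<in>angles Q. \<forall>h\<in>angles Q. Lcl Q e = Lcl Q h \<longrightarrow> Pcl Q (act Q g e) = Pcl Q (act Q g h)"
      by (simp add: angles_Q L_iff P_iff act_Q act_closed g_carrier) (use Lcl_act in blast)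
    show "\<forall>e\<in>angles Q. \<forall>h\<in>orbit G (act Q) e. deg Q e = deg Q h"
      using orbit_deg by (auto simp: angles_Q)
    show "\<forall>e\<in>angles Q. \<forall>h\<in>angles Q.
        Pcl Q e = Pcl Q h \<longleftrightarrow> Pcl Q (deg_shift G g Q e) = Pcl Q (deg_shift G g Q h)"
      by (simp add: angles_Q P_iff shift_Q deg_shift_closed) (use Pcl_deg_shift in blast)
    show "\<forall>e\<in>angles Q. \<forall>h\<in>angles Q.
        Lcl Q e = Lcl Q h \<longleftrightarrow> Lcl Q (deg_shift G g Q e) = Lcl Q (deg_shift G g Q h)"
      by (simp add: angles_Q L_iff shift_Q deg_shift_closed) (use Lcl_deg_shift in blast)
    have "\<not> strict_sublist (Lseq G g Q (s e)) (Lseq G g Q (s h))"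
      if "e \<in> angles E" "h \<in> angles E" for e h
    proof -
      have "set (Lseq G g E e) \<union> set (Lseq G g E h) \<subseteq> Pow (angles E)"
        using that Lseq_Pow by blast
      then show ?thesis
        using strict_sublist_map_inj_on[OF _ inj_on_subset[OF image_inj]]
          Lseq_incomparable[OF that] Lseq_Q that by metis
    qed
    then show "\<forall>e\<in>angles Q. \<forall>h\<in>angles Q. \<not> strict_sublist (Lseq G g Q e) (Lseq G g Q h)"
      by (simp add: angles_Q)
  qed (rule action_Q)
  have r_image: "?r ` s ` X = X" if "X \<subseteq> angles E" for X
    using that rs by force
  have "fbc_morphism G g E Q s"
    using fbc fbc_Q by (auto simp: fbc_morphism_def angles_Q act_Q Pcl_Q Lcl_Q deg_Q)
  moreover have "fbc_morphism G g Q E ?r"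
    using fbc fbc_Q
    by (auto simp: fbc_morphism_def angles_Q act_Q Pcl_Q Lcl_Q deg_Q rs act_closed r_image
        Pcl_subset Lcl_subset simp del: image_subset_iff)
  ultimately show ?thesis
    unfolding fbc_iso_def using rs inj by (auto simp: angles_Q intro!: exI[of _ s])
qed

end

section \<open>Lifting walks along a covering\<close>

text \<open>
  The end of the lift at \<open>x\<close> of a walk of the base. In the last clause \<^const>\<open>inv_into\<close> is meaningful
  only if \<open>e\<close> lies in the image of the polygon.
\<close>

fun lift_end ::
  "('g, 'm) monoid_scheme \<Rightarrow> 'g \<Rightarrow> ('g, 'a) fbc \<Rightarrow> ('a \<Rightarrow> 'b) \<Rightarrow> 'b walk \<Rightarrow> 'a \<Rightarrow> 'a" where
  "lift_end G g E f (Stay _) x = x"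
| "lift_end G g E f (Step _ Fwd w) x = act E g (lift_end G g E f w x)"
| "lift_end G g E f (Step _ Bwd w) x = act E (inv\<^bsub>G\<^esub> g) (lift_end G g E f w x)"
| "lift_end G g E f (Step e Tau w) x = inv_into (Pcl E (lift_end G g E f w x)) f e"

lemma lift_end_wcomp:
  assumes "wtarget v = wsource u"
  shows "lift_end G g E f (wcomp u v) x = lift_end G g E f u (lift_end G g E f v x)"
  using assms
proof (induction u)
  case (Step e \<delta> u)
  then show ?case by (cases \<delta>) auto
qed simp

locale covering = fbc G g E + base: fbc G g E'
  for G :: "('g, 'm) monoid_scheme" and g :: 'g
    and E :: "('g, 'a) fbc" and E' :: "('g, 'b) fbc" +
  fixes f :: "'a \<Rightarrow> 'b"
  assumes cov: "fbc_covering G g E E' f"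
begin

lemma map_angles: "e \<in> angles E \<Longrightarrow> f e \<in> angles E'"
  and map_act: "a \<in> carrier G \<Longrightarrow> e \<in> angles E \<Longrightarrow> f (act E a e) = act E' a (f e)"
  and map_deg: "e \<in> angles E \<Longrightarrow> deg E' (f e) = deg E e"
  and bij_Pcl: "e \<in> angles E \<Longrightarrow> bij_betw f (Pcl E e) (Pcl E' (f e))"
  and bij_Lcl: "e \<in> angles E \<Longrightarrow> bij_betw f (Lcl E e) (Lcl E' (f e))"
  using cov unfolding fbc_covering_def fbc_morphism_def by auto

lemma map_Pcl: "e \<in> angles E \<Longrightarrow> f ` Pcl E e = Pcl E' (f e)"
  and map_Lcl: "e \<in> angles E \<Longrightarrow> f ` Lcl E e = Lcl E' (f e)"
  using bij_Pcl bij_Lcl by (auto simp: bij_betw_def)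

text \<open>This is the uniqueness of the lift of a \<tau> step.\<close>

lemma inj_Pcl:
  "\<lbrakk>x \<in> angles E; y \<in> Pcl E x; z \<in> Pcl E x; f y = f z\<rbrakk> \<Longrightarrow> y = z"
  using bij_Pcl by (metis bij_betw_imp_inj_on inj_on_eq_iff)

lemma map_deg_shift: "e \<in> angles E \<Longrightarrow> f (deg_shift G g E e) = deg_shift G g E' (f e)"
  by (simp add: deg_shift_def map_act pow_g_carrier map_deg)

lemma map_walk_is_walk: "is_walk G g E w \<Longrightarrow> is_walk G g E' (map_walk f w)"
proof (induction w)
  case (Step e \<delta> w)
  then have e: "e \<in> angles E" and t: "wtarget w \<in> angles E"
    using wtarget_in_angles by auto
  have "f e \<in> Pcl E' (f (wtarget w))" if "Pcl E e = Pcl E (wtarget w)"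
    using that e t map_Pcl[OF t] Pcl_self[OF e] by blast
  then have "Pcl E e = Pcl E (wtarget w) \<Longrightarrow> Pcl E' (f e) = Pcl E' (f (wtarget w))"
    using base.Pcl_eq_iff[OF map_angles[OF t] map_angles[OF e]] by simp
  then show ?case
    using Step e t map_angles[OF e] by (cases \<delta>) (auto simp: map_act g_carrier inv_g_carrier)
qed (simp add: map_angles)

abbreviation lift where "lift \<equiv> lift_end G g E f"

lemmas lift_wcomp = lift_end_wcomp[of _ _ G g E f]

text \<open>This is the existence of the lift of a \<tau> step, as \<open>f\<close> maps polygons
  onto polygons.\<close>

lemma inv_into_Pcl:
  assumes "x \<in> angles E" "e \<in> Pcl E' (f x)"
  shows "inv_into (Pcl E x) f e \<in> Pcl E x" "f (inv_into (Pcl E x) f e) = e"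
    "inv_into (Pcl E x) f e \<in> angles E"
  using assms map_Pcl[OF assms(1)] inv_into_into[of e f "Pcl E x"] f_inv_into_f[of e f "Pcl E x"]
    Pcl_subset[OF assms(1)] by auto

lemma inv_into_Pcl_eqI:
  "\<lbrakk>x \<in> angles E; y \<in> Pcl E x; f y = e\<rbrakk> \<Longrightarrow> inv_into (Pcl E x) f e = y"
  using bij_Pcl by (metis bij_betw_imp_inj_on inv_into_f_f)

lemma lift_end_props:
  assumes "is_walk G g E' w" "x \<in> angles E" "f x = wsource w"
  shows "lift w x \<in> angles E" "f (lift w x) = wtarget w"
proof -
  have "lift w x \<in> angles E \<and> f (lift w x) = wtarget w"
    using assms
  proof (induction w)
    case (Step e \<delta> w)
    then have IH: "lift w x \<in> angles E" "f (lift w x) = wtarget w" by auto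
    show ?case
    proof (cases \<delta>)
      case Tau
      then have "e \<in> Pcl E' (f (lift w x))"
        using Step.prems IH base.Pcl_self by auto
      then show ?thesis using Tau inv_into_Pcl[OF IH(1)] by simp
    qed (use Step.prems IH in \<open>auto simp: act_closed map_act g_carrier inv_g_carrier\<close>)
  qed simp
  then show "lift w x \<in> angles E" "f (lift w x) = wtarget w" by auto
qed

text \<open>Every step of a lift can be undone: a \<open>g\<close> or inverse step by the action, a
  \<tau> step because a common end puts the two previous angles into one polygon, where
  \<open>f\<close> is injective. This stands in for the reversal of walks.\<close>

lemma lift_end_inj:
  assumes "is_walk G g E' w" "x \<in> angles E" "f x = wsource w" "y \<in> angles E" "f y = wsource w"
    and "lift w x = lift w y"
  shows "x = y"
  using assms
proof (induction w)
  case (Step e \<delta> w)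
  then have w: "is_walk G g E' w" by simp
  have x: "lift w x \<in> angles E" "f (lift w x) = wtarget w"
    using Step.prems lift_end_props[OF w] by auto
  have y: "lift w y \<in> angles E" "f (lift w y) = wtarget w"
    using Step.prems lift_end_props[OF w] by auto
  have "lift w x = lift w y"
  proof (cases \<delta>)
    case Fwd
    then show ?thesis using Step.prems x y act_inv_left[OF g_carrier] by (metis lift_end.simps(2))
  next
    case Bwd
    then show ?thesis using Step.prems x y act_inv_right[OF g_carrier] by (metis lift_end.simps(3))
  next
    case Tau
    then have e: "e \<in> Pcl E' (wtarget w)" using Step.prems base.Pcl_self by auto
    let ?z = "inv_into (Pcl E (lift w x)) f e"
    have eq: "?z = inv_into (Pcl E (lift w y)) f e" using Step.prems Tau by simp
    have "?z \<in> Pcl E (lift w x)" "?z \<in> angles E"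
      using inv_into_Pcl[OF x(1)] e x(2) by auto
    moreover have "?z \<in> Pcl E (lift w y)"
      using inv_into_Pcl[OF y(1)] e y(2) eq by auto
    ultimately have "Pcl E (lift w x) = Pcl E (lift w y)" using Pcl_eq_iff x y by blast
    then show ?thesis using inj_Pcl[OF x(1)] Pcl_self x y by metis
  qed
  then show ?case using Step by simp
qed simp

text \<open>By uniqueness, the lift of the image of \<open>w\<close> is \<open>w\<close> itself: at
  a \<tau> step, \<open>e\<close> is the only angle over \<open>f e\<close> in the polygon
  reached.\<close>

lemma lift_end_map_walk:
  assumes "is_walk G g E w"
  shows "lift (map_walk f w) (wsource w) = wtarget w"
  using assms
proof (induction w)
  case (Step e \<delta> w)
  then have "lift (map_walk f w) (wsource w) = wtarget w" by simp
  moreover have "wtarget w \<in> angles E" using Step.prems wtarget_in_angles by auto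
  moreover have "e \<in> Pcl E (wtarget w)" if "\<delta> = Tau"
    using that Step.prems Pcl_self by auto
  ultimately show ?case using Step.prems by (cases \<delta>) (auto simp: inv_into_Pcl_eqI)
qed simp

lemma lift_end_gwalk:
  "x \<in> angles E \<Longrightarrow> lift (gwalk G g E' n e) x = act E (g [^]\<^bsub>G\<^esub> n) x"
proof (induction n)
  case (Suc n)
  then show ?case using act_pow_Suc[of x n] by simp
qed (simp add: act_one)

text \<open>The class \<open>Lcl E x\<close> contains an angle over \<open>e\<close>; by (f1) it
  lies in the polygon of \<open>x\<close>, where it is the only such angle and hence the one chosen
  by \<open>inv_into\<close>.\<close>

lemma lift_Lcl:
  assumes "x \<in> angles E" "e \<in> Lcl E' (f x)"
  shows "inv_into (Pcl E x) f e \<in> Lcl E x"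
proof -
  obtain y where y: "y \<in> Lcl E x" "f y = e" using assms(2) map_Lcl[OF assms(1), symmetric] by auto
  then show ?thesis using inv_into_Pcl_eqI[of x y e] assms(1) Lcl_subset_Pcl[OF assms(1)] by auto
qed

lemma lift_end_homotopic:
  assumes "homotopic G g E' v w" "x \<in> angles E" "f x = wsource v"
  shows "lift v x = lift w x"
proof -
  \<comment> \<open>The start is quantified inside the induction, since in the right-hand case of
    (h5) the hypothesis is applied at the end of the lift of \<open>v\<close>.\<close>
  have "\<forall>x\<in>angles E. f x = wsource v \<longrightarrow> lift v x = lift w x"
    using assms(1)
  proof induction
    case (sym v w)
    then show ?case using base.homotopic_walks[OF sym(1)] by simp
  next
    case (trans u v w)
    then show ?case using base.homotopic_walks[OF trans(1)] by simp
  next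
    case (h1_tau e)
    then show ?case using inv_into_Pcl_eqI Pcl_self by auto
  next
    case (h2 e0 e1 e2)
    show ?case
    proof safe
      fix x assume x: "x \<in> angles E" "f x = wsource (Step e2 Tau (Step e1 Tau (Stay e0)))"
      then have fx: "f x = e0" by simp
      let ?y = "inv_into (Pcl E x) f e1" let ?z = "inv_into (Pcl E ?y) f e2"
      have "e1 \<in> Pcl E' (f x)" using h2 fx base.Pcl_self by metis
      note y = inv_into_Pcl[OF x(1) this]
      \<comment> \<open>As \<open>?y\<close> stays in the polygon of \<open>x\<close>, both sides
        take the preimage of \<open>e2\<close> in the same set.\<close>
      have P: "Pcl E ?y = Pcl E x" using y Pcl_eq_iff x by metis
      then show "lift (Step e2 Tau (Step e1 Tau (Stay e0))) x = lift (Step e2 Tau (Stay e0)) x"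
        by simp
    qed
  next
    case (h3 e h)
    show ?case
    proof safe
      fix x assume x: "x \<in> angles E" "f x = wsource (Step (deg_shift G g E' h) Tau (gwalk G g E' (deg E' e) e))"
      then have fx: "f x = e" by (simp add: base.wsource_gwalk)
      let ?y = "inv_into (Pcl E x) f h"
      have "h \<in> Pcl E' (f x)" using h3 fx base.Pcl_self by metis
      note y = inv_into_Pcl[OF x(1) this]
      have "Pcl E x = Pcl E ?y" using y Pcl_eq_iff x by metis
      \<comment> \<open>By (f4) in \<open>E\<close>, the shift of \<open>?y\<close> lies in the
        polygon of the shift of \<open>x\<close>, so it is the lift of the last \<tau> step.\<close>
      then have "deg_shift G g E ?y \<in> Pcl E (deg_shift G g E x)"
        using Pcl_deg_shift[OF x(1) y(3)] Pcl_self deg_shift_closed y(3) by metis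
      then have "inv_into (Pcl E (deg_shift G g E x)) f (deg_shift G g E' h) = deg_shift G g E ?y"
        using inv_into_Pcl_eqI deg_shift_closed x map_deg_shift y by metis
      \<comment> \<open>The lengths of the walks are degrees in \<open>E'\<close>; they equal the
        degrees in \<open>E\<close> because \<open>f\<close> preserves \<open>deg\<close>.\<close>
      moreover have "deg_shift G g E x = act E (g [^]\<^bsub>G\<^esub> deg E' e) x"
        "deg_shift G g E ?y = act E (g [^]\<^bsub>G\<^esub> deg E' h) ?y"
        using map_deg[OF x(1)] map_deg[OF y(3)] fx y(2) by (auto simp: deg_shift_def)
      ultimately show "lift (Step (deg_shift G g E' h) Tau (gwalk G g E' (deg E' e) e)) x =
        lift (wcomp (gwalk G g E' (deg E' h) h) (Step h Tau (Stay e))) x"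
        by (simp add: lift_end_gwalk x y lift_wcomp base.wsource_gwalk)
    qed
  next
    case (h4 e h)
    show ?case
    proof safe
      fix x assume x: "x \<in> angles E" "f x = wsource (Step (act E' g h) Tau (Step (act E' g e) Fwd (Stay e)))"
      then have fx: "f x = e" by simp
      let ?y = "inv_into (Pcl E x) f h"
      have L: "h \<in> Lcl E' (f x)" using h4 fx base.Lcl_self by metis
      then have "h \<in> Pcl E' (f x)" using base.Lcl_subset_Pcl map_angles x by blast
      note y = inv_into_Pcl[OF x(1) this]
      \<comment> \<open>The lift \<open>?y\<close> is chosen only within the polygon; (f2) applies
        because it lies in the class \<open>Lcl E x\<close> too.\<close>
      have "Lcl E x = Lcl E ?y" using Lcl_eq_iff x y lift_Lcl[OF x(1) L] by blast
      then have "act E g ?y \<in> Pcl E (act E g x)"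
        using Lcl_act[OF x(1) y(3)] Pcl_self act_closed g_carrier y(3) by metis
      then have "inv_into (Pcl E (act E g x)) f (act E' g h) = act E g ?y"
        using inv_into_Pcl_eqI act_closed g_carrier x map_act y by metis
      then show "lift (Step (act E' g h) Tau (Step (act E' g e) Fwd (Stay e))) x =
        lift (Step (act E' g h) Fwd (Step h Tau (Stay e))) x"
        by simp
    qed
  next
    case (h5_left w1 w2 u)
    then show ?case using base.homotopic_walks[OF h5_left(1)] by (simp add: lift_wcomp)
  next
    case (h5_right w1 w2 v)
    then show ?case using lift_end_props[OF h5_right(2)] by (simp add: lift_wcomp)
  qed (auto simp: act_inv_left act_inv_right g_carrier)
  then show ?thesis using assms by blast
qed

end

section \<open>Regularity and the closing up of lifts throughout a fibre\<close>

locale reg_covering = covering G g E E' f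
  for G :: "('g, 'm) monoid_scheme" and g :: 'g
    and E :: "('g, 'a) fbc" and E' :: "('g, 'b) fbc" and f :: "'a \<Rightarrow> 'b" +
  assumes regular: "regular_covering G g E E' f"
begin

lemma walk_exists:
  assumes "x \<in> angles E" "y \<in> angles E"
  obtains w where "is_walk G g E w" "wsource w = x" "wtarget w = y"
  using assms regular unfolding regular_covering_def fbc_connected_def by blast

text \<open>
  With \<open>N = f\<^sub>*(\<Pi>(E,e\<^sub>0))\<close>, the equality of cosets \<open>N c = c N\<close> rewrites \<open>f(u) c\<close> as \<open>c f(v)\<close> with \<open>v\<close>
  closed; the lift of the latter at \<open>e\<^sub>0\<close> ends where that of \<open>c\<close> does.
\<close>

lemma closed_lift_base:
  obtains e0 where "e0 \<in> angles E"
    and "\<And>u c. u \<in> closed_walks G g E e0 \<Longrightarrow> c \<in> closed_walks G g E' (f e0) \<Longrightarrow>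
      lift (map_walk f u) (lift c e0) = lift c e0"
proof -
  let ?N = "\<lambda>e. fund_map G g E' f ` carrier (fund_group G g E e)"
  obtain e0 where e0: "e0 \<in> angles E" and normal: "?N e0 \<lhd> fund_group G g E' (f e0)"
    using regular unfolding regular_covering_def by blast
  let ?\<Pi> = "fund_group G g E' (f e0)"
  let ?cl = "\<lambda>w. homotopy_rel G g E `` {w}" and ?cl' = "\<lambda>w. homotopy_rel G g E' `` {w}"
  show ?thesis
  proof (rule that[OF e0])
    fix u c assume u: "u \<in> closed_walks G g E e0" and c: "c \<in> closed_walks G g E' (f e0)"
    let ?A = "fund_map G g E' f (?cl u)"
    have fu: "is_walk G g E' (map_walk f u)" "wsource (map_walk f u) = f e0"
      using u map_walk_is_walk by (auto simp: closed_walks_def)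
    have c': "is_walk G g E' c" "wsource c = f e0" "wtarget c = f e0"
      using c by (auto simp: closed_walks_def)
    have fuA: "map_walk f u \<in> ?A"
      using u homotopic.refl[OF fu(1)] homotopic.refl[of G g E u]
      by (auto simp: fund_map_def homotopy_rel_def closed_walks_def)
    have cc: "c \<in> ?cl' c" using homotopic.refl[OF c'(1)] by (simp add: homotopy_rel_def)
    have "?cl u \<in> carrier (fund_group G g E e0)" "?cl' c \<in> carrier ?\<Pi>"
      using u c by (auto simp: fund_group_def quotient_def)
    then have "?A \<otimes>\<^bsub>?\<Pi>\<^esub> ?cl' c \<in> ?N e0 #>\<^bsub>?\<Pi>\<^esub> ?cl' c" "?cl' c \<in> carrier ?\<Pi>"
      by (auto simp: r_coset_def)
    then have "?A \<otimes>\<^bsub>?\<Pi>\<^esub> ?cl' c \<in> ?cl' c <#\<^bsub>?\<Pi>\<^esub> ?N e0"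
      using normal.coset_eq[OF normal] by auto
    then obtain B where B: "B \<in> carrier (fund_group G g E e0)"
      and AB: "?A \<otimes>\<^bsub>?\<Pi>\<^esub> ?cl' c = ?cl' c \<otimes>\<^bsub>?\<Pi>\<^esub> fund_map G g E' f B"
      by (auto simp: l_coset_def)
    obtain v where v: "v \<in> closed_walks G g E e0" and Bv: "B = ?cl v"
      using B by (auto simp: fund_group_def quotient_def)
    \<comment> \<open>Products in the fundamental group are sets of walks, so the equality
      \<open>AB\<close> makes this particular walk homotopic to a composite of representatives from
      the right-hand side.\<close>
    have "wcomp (map_walk f u) c \<in> ?A \<otimes>\<^bsub>?\<Pi>\<^esub> ?cl' c"
      using fuA cc homotopic.refl[OF is_walk_wcomp[OF fu(1) c'(1)]] fu c'
      by (auto simp: fund_group_def homotopy_rel_def)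
    then obtain q p where q: "q \<in> ?cl' c" and p: "p \<in> fund_map G g E' f B"
      and qp: "homotopic G g E' (wcomp q p) (wcomp (map_walk f u) c)"
      unfolding AB by (auto simp: fund_group_def homotopy_rel_def)
    obtain w where vw: "homotopic G g E v w" and wp: "homotopic G g E' (map_walk f w) p"
      using p unfolding Bv fund_map_def homotopy_rel_def by auto
    have w: "is_walk G g E w" "wsource w = e0" "wtarget w = e0"
      using homotopic_walks[OF vw] v by (auto simp: closed_walks_def)
    have cq: "homotopic G g E' c q" using q by (simp add: homotopy_rel_def)
    have src: "wtarget p = wsource q" "wsource p = f e0"
      using base.homotopic_walks[OF wp] base.homotopic_walks[OF cq] w c' by auto
    \<comment> \<open>The walk \<open>p\<close> is homotopic to the image of the closed walk
      \<open>w\<close>, whose lift at \<open>e0\<close> is \<open>w\<close>.\<close>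
    have "lift p e0 = e0"
      using lift_end_homotopic[OF wp e0] lift_end_map_walk[OF w(1)] w by simp
    then have "lift (wcomp q p) e0 = lift c e0"
      using lift_wcomp[OF src(1)] lift_end_homotopic[OF cq e0] c' by simp
    moreover have "lift (wcomp q p) e0 = lift (map_walk f u) (lift c e0)"
      using lift_end_homotopic[OF qp e0] src lift_wcomp[of c "map_walk f u"] fu c' by simp
    ultimately show "lift (map_walk f u) (lift c e0) = lift c e0" by simp
  qed
qed

text \<open>
  The walk \<open>k\<close> need not be the inverse of \<open>a\<close>: comparing the loops \<open>k a\<close> and \<open>k w a\<close> replaces all
  cancellation in the fundamental group.
\<close>

lemma closed_lift:
  assumes w: "w \<in> closed_walks G g E x" and y: "y \<in> angles E" "f x = f y"
  shows "lift (map_walk f w) y = y"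
proof -
  obtain e0 where e0: "e0 \<in> angles E"
    and closed: "\<And>u c. u \<in> closed_walks G g E e0 \<Longrightarrow> c \<in> closed_walks G g E' (f e0) \<Longrightarrow>
      lift (map_walk f u) (lift c e0) = lift c e0"
    using closed_lift_base by blast
  have w': "is_walk G g E w" "wsource w = x" "wtarget w = x" "x \<in> angles E"
    using w wsource_in_angles by (auto simp: closed_walks_def)
  obtain a where a: "is_walk G g E a" "wsource a = e0" "wtarget a = x"
    using walk_exists e0 w'(4) by blast
  obtain b where b: "is_walk G g E b" "wsource b = e0" "wtarget b = y"
    using walk_exists e0 y(1) by blast
  obtain k where k: "is_walk G g E k" "wsource k = x" "wtarget k = e0"
    using walk_exists e0 w'(4) by blast
  note fw = map_walk_is_walk[OF w'(1)] and fa = map_walk_is_walk[OF a(1)]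
    and fb = map_walk_is_walk[OF b(1)] and fk = map_walk_is_walk[OF k(1)]
  \<comment> \<open>The loop \<open>?c\<close> at \<open>f e0\<close> lifts from \<open>e0\<close>
    through \<open>y\<close> to \<open>?z\<close>, so \<open>closed\<close> becomes applicable at
    \<open>?z\<close>.\<close>
  let ?c = "wcomp (map_walk f k) (map_walk f b)"
  let ?z = "lift (map_walk f k) y"
  have z: "?z \<in> angles E" "f ?z = f e0"
    using lift_end_props[OF fk y(1)] k y by auto
  have c: "?c \<in> closed_walks G g E' (f e0)"
    using is_walk_wcomp[OF fk fb] b k y by (simp add: closed_walks_def)
  have cz: "lift ?c e0 = ?z"
    using lift_wcomp[of "map_walk f b" "map_walk f k"] lift_end_map_walk[OF b(1)] b k y by simp
  have za: "lift (map_walk f a) ?z \<in> angles E" "f (lift (map_walk f a) ?z) = f x"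
    using lift_end_props[OF fa z(1)] z a by auto
  have "wcomp k a \<in> closed_walks G g E e0"
    using is_walk_wcomp[OF k(1) a(1)] a k by (simp add: closed_walks_def)
  from closed[OF this c] have kz: "lift (map_walk f k) (lift (map_walk f a) ?z) = ?z"
    using lift_wcomp[of "map_walk f a" "map_walk f k"] a k by (simp add: cz map_walk_wcomp)
  \<comment> \<open>Both angles lie over \<open>f x\<close>, and lifting the image of
    \<open>k\<close> from either one ends at \<open>?z\<close>.\<close>
  have zy: "lift (map_walk f a) ?z = y"
    by (rule lift_end_inj[OF fk za(1) _ y(1) _ kz]) (simp_all add: za(2) k(2) y(2))
  have wy: "lift (map_walk f w) y \<in> angles E" "f (lift (map_walk f w) y) = f x"
    using lift_end_props[OF fw y(1)] w' y by auto
  have wa: "is_walk G g E (wcomp w a)" "wsource (wcomp w a) = e0" "wtarget (wcomp w a) = x"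
    using is_walk_wcomp[OF w'(1) a(1)] a w' by auto
  have "wcomp k (wcomp w a) \<in> closed_walks G g E e0"
    using is_walk_wcomp[OF k(1) wa(1)] wa k by (simp add: closed_walks_def)
  from closed[OF this c] have "lift (map_walk f (wcomp k (wcomp w a))) ?z = ?z"
    by (simp add: cz)
  moreover have "lift (map_walk f (wcomp k (wcomp w a))) ?z =
    lift (map_walk f k) (lift (map_walk f w) (lift (map_walk f a) ?z))"
    using lift_wcomp[of "map_walk f (wcomp w a)" "map_walk f k"]
      lift_wcomp[of "map_walk f a" "map_walk f w"] wa a w' k
    by (simp add: map_walk_wcomp)
  ultimately have kw: "lift (map_walk f k) (lift (map_walk f w) y) = lift (map_walk f k) y"
    by (simp add: zy)
  show ?thesis
    by (rule lift_end_inj[OF fk wy(1) _ y(1) _ kw]) (simp_all add: wy(2) k(2) y(2))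
qed

text \<open>Followed by a common return walk \<open>k\<close>, both walks become closed, so both
  lifts return to \<open>y\<close>; injectivity of lifting along \<open>k\<close> then identifies
  their ends.\<close>

lemma lift_end_parallel:
  assumes v: "is_walk G g E v" and w: "is_walk G g E w"
    and vw: "wsource v = wsource w" "wtarget v = wtarget w"
    and y: "y \<in> angles E" "f (wsource v) = f y"
  shows "lift (map_walk f v) y = lift (map_walk f w) y"
proof -
  obtain k where k: "is_walk G g E k" "wsource k = wtarget v" "wtarget k = wsource v"
    using walk_exists wsource_in_angles[OF v] wtarget_in_angles[OF v] by blast
  have retrace: "lift (map_walk f k) (lift (map_walk f u) y) = y"
    if u: "is_walk G g E u" "wsource u = wsource v" "wtarget u = wtarget v" for u
  proof -
    have "wcomp k u \<in> closed_walks G g E (wsource v)"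
      using is_walk_wcomp[OF k(1) u(1)] k u by (simp add: closed_walks_def)
    from closed_lift[OF this y] show ?thesis
      using lift_wcomp[of "map_walk f u" "map_walk f k"] u k by (simp add: map_walk_wcomp)
  qed
  show ?thesis
  proof (rule lift_end_inj[OF map_walk_is_walk[OF k(1)]])
    show "lift (map_walk f k) (lift (map_walk f v) y) = lift (map_walk f k) (lift (map_walk f w) y)"
      using retrace[OF v] retrace[OF w] vw by simp
  qed (use lift_end_props[OF map_walk_is_walk[OF v] y(1)] lift_end_props[OF map_walk_is_walk[OF w] y(1)]
      vw k y in auto)
qed

section \<open>Deck transformations\<close>

text \<open>For \<open>f x = f y\<close> this is the deck transformation taking \<open>x\<close> to
  \<open>y\<close>. The choice of walk is harmless by \<open>lift_end_parallel\<close>, and the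
  restriction to the angles gives the extensionality demanded by \<open>fbc_Aut\<close>.\<close>

definition deck :: "'a \<Rightarrow> 'a \<Rightarrow> 'a \<Rightarrow> 'a" where
  "deck x y = (\<lambda>z\<in>angles E.
     lift (map_walk f (SOME w. is_walk G g E w \<and> wsource w = x \<and> wtarget w = z)) y)"

context
  fixes x y assumes x: "x \<in> angles E" and y: "y \<in> angles E" and xy: "f x = f y"
begin

lemma deck_eq:
  assumes "is_walk G g E w" "wsource w = x"
  shows "deck x y (wtarget w) = lift (map_walk f w) y"
proof -
  let ?P = "\<lambda>v. is_walk G g E v \<and> wsource v = x \<and> wtarget v = wtarget w"
  have "?P (SOME v. ?P v)" using someI[of ?P w] assms by blast
  then show ?thesis
    using lift_end_parallel[of "SOME v. ?P v" w] assms x y xy wtarget_in_angles[OF assms(1)]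
    unfolding deck_def by auto
qed

lemma deck_start: "deck x y x = y"
  using deck_eq[of "Stay x"] x by simp

lemma deck_angles: "z \<in> angles E \<Longrightarrow> deck x y z \<in> angles E"
  and deck_over: "z \<in> angles E \<Longrightarrow> f (deck x y z) = f z"
proof -
  assume z: "z \<in> angles E"
  obtain w where w: "is_walk G g E w" "wsource w = x" "wtarget w = z"
    using walk_exists x z by blast
  show "deck x y z \<in> angles E" "f (deck x y z) = f z"
    using deck_eq[OF w(1,2)] w lift_end_props[OF map_walk_is_walk[OF w(1)] y] xy by auto
qed

text \<open>A walk to \<open>z\<close> extended by one step is a walk to \<open>z'\<close>; this one
  formula yields compatibility with \<open>g\<close>, with its inverse and with polygons. The angle
  in \<open>Stay (f z)\<close> is a placeholder ignored by \<open>lift\<close>.\<close>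

lemma deck_step:
  assumes z: "z \<in> angles E" and z': "z' \<in> angles E" and step: "wstep G g E \<delta> z z'"
  shows "deck x y z' = lift (Step (f z') \<delta> (Stay (f z))) (deck x y z)"
proof -
  obtain w where w: "is_walk G g E w" "wsource w = x" "wtarget w = z"
    using walk_exists x z by blast
  show ?thesis
    using deck_eq[of "Step z' \<delta> w"] deck_eq[of w] w z' step by (cases \<delta>) auto
qed

lemma deck_act:
  assumes a: "a \<in> carrier G" and z: "z \<in> angles E"
  shows "deck x y (act E a z) = act E a (deck x y z)"
proof -
  \<comment> \<open>Steps of walks only give the generator and its inverse; induction over the
    generated subgroup reaches all of \<open>G\<close>.\<close>
  have "a \<in> generate G {g}" using a cyclic by (simp add: infinite_cyclic_on_def)
  then show ?thesis using z
  proof (induction arbitrary: z)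
    case one
    then show ?case by (simp add: act_one deck_angles)
  next
    case (incl h)
    then show ?case using deck_step[of z "act E g z" Fwd] act_closed g_carrier by simp
  next
    case (inv h)
    then show ?case using deck_step[of z "act E (inv\<^bsub>G\<^esub> g) z" Bwd] act_closed inv_g_carrier by simp
  next
    case (eng h1 h2)
    then have "h1 \<in> carrier G" "h2 \<in> carrier G"
      using cyclic by (auto simp: infinite_cyclic_on_def)
    then show ?case using eng by (simp add: act_mult act_closed deck_angles)
  qed
qed

lemma deck_Pcl:
  assumes z: "z \<in> angles E"
  shows "deck x y ` Pcl E z \<subseteq> Pcl E (deck x y z)"
proof
  fix t assume "t \<in> deck x y ` Pcl E z"
  then obtain z' where z': "z' \<in> Pcl E z" "t = deck x y z'" by blast
  then have a: "z' \<in> angles E" "Pcl E z' = Pcl E z"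
    using Pcl_subset[OF z] Pcl_eq_iff[OF z] by auto
  have "f z' \<in> Pcl E' (f (deck x y z))"
    using deck_over[OF z] map_Pcl[OF z] z'(1) by auto
  then show "t \<in> Pcl E (deck x y z)"
    using deck_step[OF z a(1), of Tau] a inv_into_Pcl[OF deck_angles[OF z]] z'(2) by auto
qed

text \<open>No step of a walk sees the finer partition, so it is recovered from \<open>f\<close>:
  the class of \<open>deck x y z\<close> contains an angle \<open>s\<close> over
  \<open>f z'\<close>, and within the polygon \<open>s\<close> must be the image of
  \<open>z'\<close>.\<close>

lemma deck_Lcl:
  assumes z: "z \<in> angles E"
  shows "deck x y ` Lcl E z \<subseteq> Lcl E (deck x y z)"
proof
  fix t assume "t \<in> deck x y ` Lcl E z"
  then obtain z' where z': "z' \<in> Lcl E z" "t = deck x y z'" by blast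
  have a: "z' \<in> angles E" using Lcl_subset[OF z] z' by auto
  have "f z' \<in> Lcl E' (f (deck x y z))"
    using deck_over[OF z] map_Lcl[OF z] z'(1) by auto
  then obtain s where s: "s \<in> Lcl E (deck x y z)" "f s = f z'"
    using map_Lcl[OF deck_angles[OF z]] by (metis imageE)
  have "t \<in> Pcl E (deck x y z)" "s \<in> Pcl E (deck x y z)"
    using deck_Pcl[OF z] Lcl_subset_Pcl[OF z] Lcl_subset_Pcl[OF deck_angles[OF z]] z' s(1) by auto
  then have "t = s" using inj_Pcl[OF deck_angles[OF z]] s deck_over[OF a] z' by simp
  then show "t \<in> Lcl E (deck x y z)" using s by simp
qed

lemma deck_morphism: "fbc_morphism G g E E (deck x y)"
  unfolding fbc_morphism_def
proof (intro conjI ballI)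
  show "deg E (deck x y z) = deg E z" if "z \<in> angles E" for z
    using that map_deg deck_over deck_angles by metis
qed (use fbc deck_angles deck_act deck_Pcl deck_Lcl in auto)

end

text \<open>The composite fixes \<open>x\<close>, and the property of being fixed spreads along
  walks: through the action by equivariance, and within a polygon because the composite preserves
  \<open>f\<close> and \<open>f\<close> is injective there.\<close>

lemma deck_inverse:
  assumes x: "x \<in> angles E" and y: "y \<in> angles E" and xy: "f x = f y" and z: "z \<in> angles E"
  shows "deck y x (deck x y z) = z"
proof -
  have yx: "f y = f x" using xy by simp
  obtain w where w: "is_walk G g E w" "wsource w = x" "wtarget w = z"
    using walk_exists x z by blast
  have "deck y x (deck x y (wtarget w)) = wtarget w" if "is_walk G g E w" "wsource w = x" for w
    using that
  proof (induction w)
    case (Stay e)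
    then show ?case using deck_start[OF x y xy] deck_start[OF y x yx] by simp
  next
    case (Step e \<delta> w)
    let ?t = "wtarget w"
    have t: "?t \<in> angles E" "e \<in> angles E" "wstep G g E \<delta> ?t e"
      and IH: "deck y x (deck x y ?t) = ?t"
      using Step wtarget_in_angles by auto
    note d = deck_angles[OF x y xy] and d' = deck_angles[OF y x yx]
    show ?case
    proof (cases \<delta>)
      case Tau
      then have "e \<in> Pcl E ?t" using t Pcl_self by auto
      then have "deck x y e \<in> Pcl E (deck x y ?t)" using deck_Pcl[OF x y xy t(1)] by blast
      then have "deck y x (deck x y e) \<in> Pcl E ?t"
        using deck_Pcl[OF y x yx d[OF t(1)]] IH by auto
      then show ?thesis
        using inj_Pcl[OF t(1)] \<open>e \<in> Pcl E ?t\<close> deck_over[OF x y xy t(2)] 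
          deck_over[OF y x yx d[OF t(2)]] by auto
    qed (use t IH d d' deck_act[OF x y xy] deck_act[OF y x yx] g_carrier inv_g_carrier in auto)
  qed
  from this[OF w(1,2)] show ?thesis by (simp add: w)
qed

lemma deck_Aut_over:
  assumes "x \<in> angles E" "y \<in> angles E" "f x = f y"
  shows "deck x y \<in> Aut_over G g E f"
proof -
  have "fbc_iso G g E E (deck x y)"
    unfolding fbc_iso_def
    using deck_morphism[OF assms] deck_morphism[OF assms(2,1)] deck_inverse[OF assms]
      deck_inverse[OF assms(2,1)] assms(3) by metis
  then show ?thesis
    using deck_over[OF assms] by (auto simp: Aut_over_def fbc_Aut_def deck_def)
qed

section \<open>Orbits as fibres, and surjectivity of the covering\<close>

lemma orbit_Aut_over:
  assumes e: "e \<in> angles E"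
  shows "aut_orbit E (Aut_over G g E f) e = {x \<in> angles E. f x = f e}"
proof
  have "\<phi> e \<in> angles E" if "\<phi> \<in> Aut_over G g E f" for \<phi>
    using that e by (auto simp: Aut_over_def fbc_Aut_def fbc_iso_def fbc_morphism_def)
  then show "aut_orbit E (Aut_over G g E f) e \<subseteq> {x \<in> angles E. f x = f e}"
    using e by (auto simp: aut_orbit_def orbit_def Aut_over_def)
  show "{x \<in> angles E. f x = f e} \<subseteq> aut_orbit E (Aut_over G g E f) e"
  proof safe
    fix x assume "x \<in> angles E" "f x = f e"
    then have "deck e x \<in> Aut_over G g E f" "deck e x e = x"
      using deck_Aut_over deck_start e by auto
    then show "x \<in> aut_orbit E (Aut_over G g E f) e"
      unfolding aut_orbit_def orbit_def by simp metis
  qed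
qed

text \<open>The base point in the definition of regularity supplies an angle \<open>e\<close>; a
  walk from \<open>f e\<close> to \<open>e'\<close> lifts to one ending over
  \<open>e'\<close>.\<close>

lemma fibre_nonempty:
  assumes "e' \<in> angles E'"
  obtains x where "x \<in> angles E" "f x = e'"
proof -
  obtain e where e: "e \<in> angles E" using regular unfolding regular_covering_def by blast
  obtain w where w: "is_walk G g E' w" "wsource w = f e" "wtarget w = e'"
    using regular map_angles[OF e] assms unfolding regular_covering_def fbc_connected_def by blast
  show thesis using lift_end_props[OF w(1) e] w by (intro that) auto
qed

lemma surj: "f ` angles E = angles E'"
  using map_angles by (auto elim: fibre_nonempty)

end

section \<open>The group of automorphisms over a map\<close>

context fbc
begin

lemma fbc_morphism_comp:
  assumes "fbc_morphism G g E E \<phi>" "fbc_morphism G g E E \<psi>"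
  shows "fbc_morphism G g E E (compose (angles E) \<phi> \<psi>)"
  unfolding fbc_morphism_def
proof (intro conjI ballI)
  have \<psi>: "\<psi> e \<in> angles E" if "e \<in> angles E" for e
    using assms(2) that by (auto simp: fbc_morphism_def)
  then show "compose (angles E) \<phi> \<psi> \<in> angles E \<rightarrow> angles E"
    using assms(1) by (auto simp: fbc_morphism_def compose_def)
  fix e assume e: "e \<in> angles E"
  have img: "compose (angles E) \<phi> \<psi> ` X = \<phi> ` \<psi> ` X" if "X \<subseteq> angles E" for X
    using that by (force simp: compose_def)
  show "compose (angles E) \<phi> \<psi> ` Pcl E e \<subseteq> Pcl E (compose (angles E) \<phi> \<psi> e)"
    "compose (angles E) \<phi> \<psi> ` Lcl E e \<subseteq> Lcl E (compose (angles E) \<phi> \<psi> e)"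
    using assms e \<psi>[OF e] Pcl_subset[OF e] Lcl_subset[OF e] unfolding fbc_morphism_def
    by (simp_all only: img compose_eq) (meson image_mono order_trans)+
  show "deg E (compose (angles E) \<phi> \<psi> e) = deg E e"
    using assms e \<psi>[OF e] by (simp add: fbc_morphism_def compose_def)
  show "compose (angles E) \<phi> \<psi> (act E a e) = act E a (compose (angles E) \<phi> \<psi> e)"
    if "a \<in> carrier G" for a
    using assms e \<psi>[OF e] that by (simp add: fbc_morphism_def compose_def act_closed)
qed (use fbc in auto)

lemma fbc_morphism_restrict:
  assumes "fbc_morphism G g E E \<phi>"
  shows "fbc_morphism G g E E (restrict \<phi> (angles E))"
proof -
  \<comment> \<open>In the sense of \<open>compose\<close>, composition with the identity is
    restriction to the angles.\<close>
  have "fbc_morphism G g E E (\<lambda>e. e)" using fbc by (auto simp: fbc_morphism_def)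
  from fbc_morphism_comp[OF assms this] show ?thesis by (simp add: compose_def restrict_def)
qed

lemma Aut_overI:
  assumes "\<phi> \<in> extensional (angles E)" "fbc_morphism G g E E \<phi>" "fbc_morphism G g E E h"
    and "\<And>e. e \<in> angles E \<Longrightarrow> h (\<phi> e) = e" "\<And>e. e \<in> angles E \<Longrightarrow> \<phi> (h e) = e"
    and "\<And>e. e \<in> angles E \<Longrightarrow> f (\<phi> e) = f e"
  shows "\<phi> \<in> Aut_over G g E f"
  unfolding Aut_over_def fbc_Aut_def fbc_iso_def using assms by blast

lemma Aut_over_subgroup: "subgroup (Aut_over G g E f) (BijGroup (angles E))"
proof (rule group.subgroupI[OF group_BijGroup])
  \<comment> \<open>An inverse morphism \<open>h\<close> of an element automatically preserves
    \<open>f\<close>; \<open>D\<close> records this together with the closure of the angles under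
    both maps.\<close>
  have D: "\<exists>h. fbc_morphism G g E E \<phi> \<and> fbc_morphism G g E E h \<and> (\<forall>e\<in>angles E. \<phi> e \<in> angles E \<and>
      h e \<in> angles E \<and> h (\<phi> e) = e \<and> \<phi> (h e) = e \<and> f (\<phi> e) = f e \<and> f (h e) = f e)"
    if "\<phi> \<in> Aut_over G g E f" for \<phi>
  proof -
    obtain h where h: "fbc_morphism G g E E \<phi>" "fbc_morphism G g E E h"
      "\<forall>e\<in>angles E. h (\<phi> e) = e" "\<forall>e\<in>angles E. \<phi> (h e) = e" "\<forall>e\<in>angles E. f (\<phi> e) = f e"
      using \<open>\<phi> \<in> _\<close> by (auto simp: Aut_over_def fbc_Aut_def fbc_iso_def)
    moreover have closed: "\<phi> e \<in> angles E" "h e \<in> angles E" if "e \<in> angles E" for e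
      using h(1,2) that by (auto simp: fbc_morphism_def)
    moreover have "f (h e) = f e" if "e \<in> angles E" for e
      using h(4,5) closed that by metis
    ultimately show ?thesis by blast
  qed
  show sub: "Aut_over G g E f \<subseteq> carrier (BijGroup (angles E))"
  proof
    fix \<phi> assume \<phi>: "\<phi> \<in> Aut_over G g E f"
    obtain h where "\<forall>e\<in>angles E. \<phi> e \<in> angles E \<and> h e \<in> angles E \<and> h (\<phi> e) = e \<and> \<phi> (h e) = e"
      using D[OF \<phi>] by blast
    then have "bij_betw \<phi> (angles E) (angles E)"
      by (intro bij_betw_byWitness[where f' = h]) auto
    then show "\<phi> \<in> carrier (BijGroup (angles E))"
      using \<phi> by (auto simp: BijGroup_def Bij_def Aut_over_def fbc_Aut_def)
  qed
  have "fbc_morphism G g E E (\<lambda>e\<in>angles E. e)"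
    by (rule fbc_morphism_restrict) (use fbc in \<open>auto simp: fbc_morphism_def\<close>)
  then have "(\<lambda>e\<in>angles E. e) \<in> Aut_over G g E f"
    by (intro Aut_overI[of _ "\<lambda>e\<in>angles E. e"]) auto
  then show "Aut_over G g E f \<noteq> {}" by blast
  show "inv\<^bsub>BijGroup (angles E)\<^esub> \<phi> \<in> Aut_over G g E f" if \<phi>: "\<phi> \<in> Aut_over G g E f" for \<phi>
  proof -
    obtain h where h: "fbc_morphism G g E E \<phi>" "fbc_morphism G g E E h"
      "\<forall>e\<in>angles E. \<phi> e \<in> angles E \<and> h e \<in> angles E \<and> h (\<phi> e) = e \<and> \<phi> (h e) = e \<and> f (h e) = f e"
      using D[OF \<phi>] by blast
    have inj: "inj_on \<phi> (angles E)" using h(3) by (metis inj_onI)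
    \<comment> \<open>The inverse in \<open>BijGroup\<close> is a restricted
      \<open>inv_into\<close>, which agrees on the angles with the inverse morphism
      \<open>h\<close>.\<close>
    have "inv\<^bsub>BijGroup (angles E)\<^esub> \<phi> = (\<lambda>e\<in>angles E. inv_into (angles E) \<phi> e)"
      using sub \<phi> by (intro inv_BijGroup) (auto simp: BijGroup_def)
    also have "\<dots> = restrict h (angles E)"
      using h(3) inj by (intro restrict_ext) (metis inv_into_f_f)
    finally show ?thesis
      using h(3) by (simp, intro Aut_overI[OF _ fbc_morphism_restrict[OF h(2)] h(1)]) auto
  qed
  show "\<phi> \<otimes>\<^bsub>BijGroup (angles E)\<^esub> \<psi> \<in> Aut_over G g E f"
    if \<phi>: "\<phi> \<in> Aut_over G g E f" and \<psi>: "\<psi> \<in> Aut_over G g E f" for \<phi> \<psi>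
  proof -
    obtain h where h: "fbc_morphism G g E E \<phi>" "fbc_morphism G g E E h"
      "\<forall>e\<in>angles E. \<phi> e \<in> angles E \<and> h e \<in> angles E \<and> h (\<phi> e) = e \<and> \<phi> (h e) = e \<and> f (\<phi> e) = f e"
      using D[OF \<phi>] by blast
    obtain k where k: "fbc_morphism G g E E \<psi>" "fbc_morphism G g E E k"
      "\<forall>e\<in>angles E. \<psi> e \<in> angles E \<and> k e \<in> angles E \<and> k (\<psi> e) = e \<and> \<psi> (k e) = e \<and> f (\<psi> e) = f e"
      using D[OF \<psi>] by blast
    have "\<phi> \<otimes>\<^bsub>BijGroup (angles E)\<^esub> \<psi> = compose (angles E) \<phi> \<psi>"
      using sub \<phi> \<psi> by (auto simp: BijGroup_def)
    moreover have "compose (angles E) \<phi> \<psi> \<in> Aut_over G g E f"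
      by (rule Aut_overI[OF _ fbc_morphism_comp[OF h(1) k(1)] fbc_morphism_comp[OF k(2) h(2)]])
        (simp_all add: compose_eq h(3) k(3))
    ultimately show ?thesis by simp
  qed
qed

end

section \<open>Admissibility and the identification of the quotient\<close>

theorem theorem1p3:
  fixes G :: "('g, 'm) monoid_scheme" and g :: 'g
    and E :: "('g, 'a) fbc" and E' :: "('g, 'b) fbc" and f :: "'a \<Rightarrow> 'b"
  assumes "infinite_cyclic_on G g"
    and "is_fbc G g E" and "fbc_connected G g E"
    and "is_fbc G g E'" and "fbc_connected G g E'"
    and "regular_covering G g E E' f"
  shows "acts_admissibly G g E (Aut_over G g E f) \<and>
    (\<exists>r. fbc_iso G g (quotient_fbc E (Aut_over G g E f)) E' r \<and>
       (\<forall>e\<in>angles E. r (aut_orbit E (Aut_over G g E f) e) = f e))"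
proof -
  have "fbc_covering G g E E' f"
    using assms(6) unfolding regular_covering_def by (elim conjE)
  then interpret reg_covering G g E E' f
    using assms(1,2,4,6) by unfold_locales
  let ?H = "Aut_over G g E f"
  let ?Q = "quotient_fbc E ?H"
  \<comment> \<open>The fibre map \<open>s\<close> is to be the inverse of the required
    \<open>r\<close>; since orbits are fibres, its values on \<open>angles E'\<close> are the angles
    of the quotient.\<close>
  define s where "s e' = {x \<in> angles E. f x = e'}" for e'
  have orb: "aut_orbit E ?H e = s (f e)" if "e \<in> angles E" for e
    using orbit_Aut_over[OF that] by (simp add: s_def)
  have inj_s: "inj_on s (angles E')"
  proof (rule inj_onI)
    fix e h assume e: "e \<in> angles E'" and "s e = s h"
    moreover obtain x where "x \<in> angles E" "f x = e" by (rule fibre_nonempty[OF e])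
    ultimately have "x \<in> s h" by (auto simp: s_def)
    then show "e = h" using \<open>f x = e\<close> by (simp add: s_def)
  qed
  have "acts_admissibly G g E ?H"
    unfolding acts_admissibly_def
  proof (intro conjI ballI)
    show "subgroup ?H (BijGroup (angles E))" by (rule Aut_over_subgroup)
    show "?H \<subseteq> fbc_Aut G g E" by (auto simp: Aut_over_def)
    fix e X x y
    assume "e \<in> angles E" "X \<in> polys E" "x \<in> aut_orbit E ?H e \<inter> X" "y \<in> aut_orbit E ?H e \<inter> X"
    \<comment> \<open>Angles of one orbit have the same image, and \<open>f\<close> is injective on
      the polygon \<open>X\<close>.\<close>
    then show "x = y"
      using inj_Pcl[of x x y] Pcl_eqI[of X x] by (auto simp: orb s_def)
  qed
  moreover have "fbc_iso G g ?Q E' (inv_into (angles E') s)"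
  \<comment> \<open>Here \<open>E'\<close> is the source and the quotient is its renamed copy, so
    the axioms for the quotient come from those for \<open>E'\<close>.\<close>
  proof (rule base.transport[OF inj_s])
    show angles_Q: "angles ?Q = s ` angles E'"
      unfolding surj[symmetric] by (simp add: quotient_fbc_def orb image_image)
    \<comment> \<open>The quotient acts by taking images of whole orbits, so a fibre must be mapped
      onto a fibre; the inverse element gives surjectivity.\<close>
    have act_fibre: "act E a ` s e = s (act E' a e)" if a: "a \<in> carrier G" and e: "e \<in> angles E'" for a e
    proof (intro subset_antisym subsetI)
      fix y assume "y \<in> s (act E' a e)"
      then have y: "y \<in> angles E" "f y = act E' a e" by (auto simp: s_def)
      have i: "inv\<^bsub>G\<^esub> a \<in> carrier G" using group a by (simp add: group.inv_closed)
      then have "act E (inv\<^bsub>G\<^esub> a) y \<in> s e"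
        using y a e by (simp add: s_def act_closed map_act base.act_inv_left)
      then show "y \<in> act E a ` s e" using act_inv_right[OF a y(1)] by (metis imageI)
    qed (use a in \<open>auto simp: s_def act_closed map_act\<close>)
    show "act ?Q a (s e) = s (act E' a e)" if "a \<in> carrier G" "e \<in> angles E'" for a e
      using that angles_Q act_fibre by (auto simp: quotient_fbc_def)
    show "act ?Q a \<in> extensional (angles ?Q)" for a by (simp add: quotient_fbc_def)
    \<comment> \<open>On angles, the orbit map is \<open>f\<close> followed by \<open>s\<close>, and
      \<open>f\<close> maps classes onto classes.\<close>
    have class_orbits: "aut_orbit E ?H ` X = s ` f ` X" if "X \<subseteq> angles E" for X
      unfolding image_image by (rule image_cong) (use that orb in auto)
    have "(`) (aut_orbit E ?H) ` polys E = (\<lambda>e. s ` Pcl E' (f e)) ` angles E"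
      unfolding polys_eq image_image
      by (rule image_cong) (simp_all add: class_orbits Pcl_subset map_Pcl)
    moreover have "(`) (aut_orbit E ?H) ` lparts E = (\<lambda>e. s ` Lcl E' (f e)) ` angles E"
      unfolding lparts_eq image_image
      by (rule image_cong) (simp_all add: class_orbits Lcl_subset map_Lcl)
    ultimately show "polys ?Q = (`) s ` polys E'" "lparts ?Q = (`) s ` lparts E'"
      unfolding base.polys_eq base.lparts_eq surj[symmetric]
      by (simp_all add: quotient_fbc_def image_image)
    show "deg ?Q (s e) = deg E' e" if e: "e \<in> angles E'" for e
    proof -
      obtain x where x: "x \<in> angles E" "f x = e" by (rule fibre_nonempty[OF e])
      \<comment> \<open>The degree is constant on the fibre because \<open>f\<close> preserves it;
        the angle \<open>x\<close> in the fibre makes the value unique.\<close>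
      have "(THE n. \<forall>y\<in>s e. deg E y = n) = deg E' e"
      proof (rule the_equality)
        show "\<forall>y\<in>s e. deg E y = deg E' e"
          using map_deg[symmetric] by (auto simp: s_def)
        then show "n = deg E' e" if "\<forall>y\<in>s e. deg E y = n" for n
          using that x by (auto simp: s_def)
      qed
      then show ?thesis by (simp add: quotient_fbc_def)
    qed
  qed
  moreover have "inv_into (angles E') s (aut_orbit E ?H e) = f e" if "e \<in> angles E" for e
    unfolding orb[OF that] using inj_s map_angles[OF that] by (rule inv_into_f_f)
  ultimately show ?thesis by blast
qed

end
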